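(* For every $t\in\{0,1,\dots,T\}$ the value function $V_t^*$ is convex in $\sigma$: for all sufficient statistics $\sigma_1,\sigma_2$ and all $0\le\lambda\le 1$, $$V_t^*(\lambda\sigma_1+(1-\lambda)\sigma_2)\le \lambda V_t^*(\sigma_1)+(1-\lambda)V_t^*(\sigma_2).$$
   Context: Hybrid system. The state is $s=(x,q)\in\mathcal{S}=\mathcal{X}\times\mathcal{Q}$ with $\mathcal{X}\subseteq\mathbb{R}^n$ and $\mathcal{Q}$ a finite set of $N_q$ modes (functions on $\mathcal{X}$ are extended by zero to $\mathbb{R}^n$). The control space $\mathcal{U}$ is a compact Borel space. The transition kernel has the form $\tau(x',q'\mid x,q,u)=T_x(x'\mid x,u,q')\,T_q(q'\mid x,q,u)$, where $T_q(\cdot\mid x,q,u)$ is a probability distribution on $\mathcal{Q}$ and $T_x(\cdot\mid x,u,q')$ is a probability density on $\mathbb{R}^n$, both measurable in their arguments. $K\subseteq\mathcal{X}\times\mathcal{Q}$ is a Borel set (the safe set), $\mathbf{1}_K$ its indicator function, and $T\in\mathbb{N}$ the time horizon. Observations. $y=(y^x,y^q)$. The component $y^q$ takes values in a finite set of $N_{y^q}$ elements, and $Q_{q,y^q}(u)$ is the probability of observing $y^q$ when the mode is $q$ and the preceding control was $u$. The component $y^x$ is of one of two types: (continuous) $y^x\in\mathbb{R}^n$, $y^x=h(x,u)+v$ with $h$ bounded and continuous and $v$ having positive probability density $\varphi$; (discrete) $y^x$ takes values in a finite set of $N_{y^x}$ elements, with $\varphi(y^x\mid x,u)$ the probability of observing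 $y^x$ when the continuous state is $x$ and the preceding control was $u$. Sufficient statistics are nonnegative integrable functions $\sigma$ on $\mathcal{S}$, and $\langle f,g\rangle=\sum_{q\in\mathcal{Q}}\int_{\mathbb{R}^n} f(x,q)g(x,q)\,dx$. Update operator. In the discrete case $$\Phi_{y,u}[\sigma](x',q')=N_{y^q}N_{y^x}\,Q_{q',y^q}(u)\,\varphi(y^x\mid x',u)\sum_{q\in\mathcal{Q}}\int_{\mathbb{R}^n}\mathbf{1}_K(x,q)\,\tau(x',q'\mid x,q,u)\,\sigma(x,q)\,dx,$$ and in the continuous case $N_{y^x}\varphi(y^x\mid x',u)$ is replaced by $\varphi(y^x-h(x',u))/\varphi(y^x)$. Value functions. $V_T^*(\sigma)=\langle\sigma,\mathbf{1}_K\rangle$ and, for $t<T$, $V_t^*(\sigma)=\sup_{u\in\mathcal{U}}\mathbb{E}^{\dagger}[V_{t+1}^*(\Phi_{y,u}[\sigma])]$. Here $\mathbb{E}^\dagger$ is expectation over $y$ under the reference measure: $y^q$ is uniform on its $N_{y^q}$ values, independent of $y^x$, and $y^x$ has density $\varphi$ (continuous case) or is uniform on its $N_{y^x}$ values (discrete case). *)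

theory Defs
  imports "HOL-Analysis.Analysis"
begin

text \<open>
  States are pairs of a point of \<open>X\<close> and a mode, the modes being the elements of
  the finite type \<open>'q\<close>. A compact Borel space of controls is the same as a compact
  metrizable space, hence a compact subset \<open>U\<close> of some Polish space.
  \<open>Tx x' x u q'\<close>, \<open>Tq q' x q u\<close> and \<open>Qo q yq u\<close> are T_x(x' | x, u, q'), T_q(q' | x, q, u)
  and Q_{q,yq}(u). The data are constrained only for points of \<open>X\<close> and controls in \<open>U\<close>.
\<close>

locale hybrid_system =
  fixes X :: "(real ^ 'n) set"
    and U :: "'u :: polish_space set"
    and K :: "((real ^ 'n) \<times> 'q :: finite) set"
    and Tx :: "real ^ 'n \<Rightarrow> real ^ 'n \<Rightarrow> 'u \<Rightarrow> 'q \<Rightarrow> real"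
    and Tq :: "'q \<Rightarrow> real ^ 'n \<Rightarrow> 'q \<Rightarrow> 'u \<Rightarrow> real"
    and Qo :: "'q \<Rightarrow> 'o :: finite \<Rightarrow> 'u \<Rightarrow> real"
  assumes X_borel: "X \<in> sets borel"
    and U_compact: "compact U"
    and U_nonempty: "U \<noteq> {}"
    and K_borel: "K \<in> sets (borel \<Otimes>\<^sub>M count_space UNIV)"
    and K_subset: "K \<subseteq> X \<times> UNIV"
    and Tx_measurable: "\<And>q'. (\<lambda>(x', x, u). Tx x' x u q') \<in>
          borel_measurable (borel \<Otimes>\<^sub>M restrict_space borel X \<Otimes>\<^sub>M restrict_space borel U)"
    and Tx_nonneg: "\<And>x' x u q'. x \<in> X \<Longrightarrow> u \<in> U \<Longrightarrow> 0 \<le> Tx x' x u q'"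
    and Tx_density: "\<And>x u q'. x \<in> X \<Longrightarrow> u \<in> U \<Longrightarrow>
          has_bochner_integral lborel (\<lambda>x'. Tx x' x u q') 1"
    and Tq_measurable: "\<And>q' q. (\<lambda>(x, u). Tq q' x q u) \<in>
          borel_measurable (restrict_space borel X \<Otimes>\<^sub>M restrict_space borel U)"
    and Tq_nonneg: "\<And>q' x q u. x \<in> X \<Longrightarrow> u \<in> U \<Longrightarrow> 0 \<le> Tq q' x q u"
    and Tq_sum: "\<And>x q u. x \<in> X \<Longrightarrow> u \<in> U \<Longrightarrow> (\<Sum>q'\<in>UNIV. Tq q' x q u) = 1"
    and Qo_nonneg: "\<And>q yq u. u \<in> U \<Longrightarrow> 0 \<le> Qo q yq u"
    and Qo_sum: "\<And>q u. u \<in> U \<Longrightarrow> (\<Sum>yq\<in>UNIV. Qo q yq u) = 1"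
begin

definition tau :: "real ^ 'n \<Rightarrow> 'q \<Rightarrow> real ^ 'n \<Rightarrow> 'q \<Rightarrow> 'u \<Rightarrow> real" where
  "tau x' q' x q u = Tx x' x u q' * Tq q' x q u"

text \<open>Functions on the state space are extended by zero to \<open>(real ^ 'n) \<times> 'q\<close>.\<close>

definition sufficient_statistic :: "((real ^ 'n) \<times> 'q \<Rightarrow> real) \<Rightarrow> bool" where
  "sufficient_statistic \<sigma> \<longleftrightarrow>
     (\<forall>s. 0 \<le> \<sigma> s) \<and> (\<forall>x q. x \<notin> X \<longrightarrow> \<sigma> (x, q) = 0) \<and>
     (\<forall>q. integrable lborel (\<lambda>x. \<sigma> (x, q)))"

definition pairing :: "((real ^ 'n) \<times> 'q \<Rightarrow> real) \<Rightarrow> ((real ^ 'n) \<times> 'q \<Rightarrow> real) \<Rightarrow> real" where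
  "pairing f g = (\<Sum>q\<in>UNIV. LINT x|lborel. f (x, q) * g (x, q))"

text \<open>
  The two kinds of continuous-state observation differ only in the likelihood ratio
  \<open>w yx x' u\<close> and in the reference law \<open>M\<close> of \<open>yx\<close>; both are supplied in the locales below.
\<close>

definition update ::
  "('y \<Rightarrow> real ^ 'n \<Rightarrow> 'u \<Rightarrow> real) \<Rightarrow> 'y \<times> 'o \<Rightarrow> 'u \<Rightarrow>
   ((real ^ 'n) \<times> 'q \<Rightarrow> real) \<Rightarrow> ((real ^ 'n) \<times> 'q \<Rightarrow> real)" where
  "update w = (\<lambda>(yx, yq) u \<sigma> (x', q').
     if x' \<in> X then
       real CARD('o) * Qo q' yq u * w yx x' u *
         (\<Sum>q\<in>UNIV. LINT x|lborel. indicator K (x, q) * tau x' q' x q u * \<sigma> (x, q))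
     else 0)"

definition reference :: "'y measure \<Rightarrow> ('y \<times> 'o) measure" where
  "reference M = M \<Otimes>\<^sub>M uniform_count_measure UNIV"

text \<open>
  With time horizon \<open>T\<close> and stage \<open>t\<close>, the value functions live on sufficient
  statistics and are set to 0 elsewhere. The update of a sufficient statistic may fail
  to be integrable for some \<open>y\<close>, but these form a null set of the reference measure, so
  the convention does not affect the integral below. The supremum is over a set bounded
  by the L1 norm of \<open>\<sigma>\<close>.
\<close>

function value_fun ::
  "'y measure \<Rightarrow> ('y \<Rightarrow> real ^ 'n \<Rightarrow> 'u \<Rightarrow> real) \<Rightarrow> nat \<Rightarrow> nat \<Rightarrow>
   ((real ^ 'n) \<times> 'q \<Rightarrow> real) \<Rightarrow> real" where
  "value_fun M w T t \<sigma> =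
     (if \<not> sufficient_statistic \<sigma> then 0
      else if t < T then
        (SUP u\<in>U. LINT y|reference M. value_fun M w T (t + 1) (update w y u \<sigma>))
      else pairing \<sigma> (indicator K))"
  by pat_completeness auto
termination
  by (relation "Wellfounded.measure (\<lambda>(M, w, T, t, \<sigma>). T - t)") auto

end

text \<open>Observations \<open>yx = h x u + v\<close>, where \<open>v\<close> has the positive density \<open>\<phi>\<close>.\<close>

locale continuous_observation = hybrid_system X U K Tx Tq Qo
  for X :: "(real ^ 'n) set"
    and U :: "'u :: polish_space set"
    and K :: "((real ^ 'n) \<times> 'q :: finite) set"
    and Tx :: "real ^ 'n \<Rightarrow> real ^ 'n \<Rightarrow> 'u \<Rightarrow> 'q \<Rightarrow> real"
    and Tq :: "'q \<Rightarrow> real ^ 'n \<Rightarrow> 'q \<Rightarrow> 'u \<Rightarrow> real"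
    and Qo :: "'q \<Rightarrow> 'o :: finite \<Rightarrow> 'u \<Rightarrow> real" +
  fixes h :: "real ^ 'n \<Rightarrow> 'u \<Rightarrow> real ^ 'n"
    and \<phi> :: "real ^ 'n \<Rightarrow> real"
  assumes h_continuous: "continuous_on (X \<times> U) (\<lambda>(x, u). h x u)"
    and h_bounded: "bounded ((\<lambda>(x, u). h x u) ` (X \<times> U))"
    and \<phi>_pos: "\<And>v. 0 < \<phi> v"
    and \<phi>_density: "has_bochner_integral lborel \<phi> 1"
begin

definition V :: "nat \<Rightarrow> nat \<Rightarrow> ((real ^ 'n) \<times> 'q \<Rightarrow> real) \<Rightarrow> real" where
  "V = value_fun (density lborel (\<lambda>v. ennreal (\<phi> v))) (\<lambda>yx x u. \<phi> (yx - h x u) / \<phi> yx)"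

end

text \<open>\<open>\<phi> yx x u\<close> is the probability of observing \<open>yx\<close> in the finite type \<open>'p\<close>.\<close>

locale discrete_observation = hybrid_system X U K Tx Tq Qo
  for X :: "(real ^ 'n) set"
    and U :: "'u :: polish_space set"
    and K :: "((real ^ 'n) \<times> 'q :: finite) set"
    and Tx :: "real ^ 'n \<Rightarrow> real ^ 'n \<Rightarrow> 'u \<Rightarrow> 'q \<Rightarrow> real"
    and Tq :: "'q \<Rightarrow> real ^ 'n \<Rightarrow> 'q \<Rightarrow> 'u \<Rightarrow> real"
    and Qo :: "'q \<Rightarrow> 'o :: finite \<Rightarrow> 'u \<Rightarrow> real" +
  fixes \<phi> :: "'p :: finite \<Rightarrow> real ^ 'n \<Rightarrow> 'u \<Rightarrow> real"
  assumes \<phi>_measurable: "\<And>yx u. u \<in> U \<Longrightarrow>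
          (\<lambda>x. \<phi> yx x u) \<in> borel_measurable (restrict_space borel X)"
    and \<phi>_nonneg: "\<And>yx x u. x \<in> X \<Longrightarrow> u \<in> U \<Longrightarrow> 0 \<le> \<phi> yx x u"
    and \<phi>_sum: "\<And>x u. x \<in> X \<Longrightarrow> u \<in> U \<Longrightarrow> (\<Sum>yx\<in>UNIV. \<phi> yx x u) = 1"
begin

definition V :: "nat \<Rightarrow> nat \<Rightarrow> ((real ^ 'n) \<times> 'q \<Rightarrow> real) \<Rightarrow> real" where
  "V = value_fun (uniform_count_measure UNIV) (\<lambda>yx x u. real CARD('p) * \<phi> yx x u)"

end

end

theory Submission
  imports Defs
begin

text \<open>
  For fixed \<open>y\<close> and \<open>u\<close> the update operator is linear up to null sets, so a downward induction
  on \<open>t\<close> gives convexity: an expectation of convex functions of a linear argument is convex,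
  and so is a supremum of such expectations. The delicate point is that
  \<open>y \<mapsto> V_{t+1} (update w y u \<sigma>)\<close> has to be measurable, although \<open>V_{t+1}\<close> is itself an uncountable
  supremum. This is handled by carrying through the induction that \<open>V_t\<close> is 1-Lipschitz for the
  L1 distance, which works because the update is L1-contractive in expectation. The sections
  \<open>F (y, \<cdot>)\<close> of a jointly measurable \<open>F\<close> form a separable subset of L1, and an L1-Lipschitz
  function of such sections is therefore measurable in \<open>y\<close>.
\<close>

section \<open>Sections of jointly measurable functions in L1\<close>

definition L1_dist :: "'a measure \<Rightarrow> ('a \<Rightarrow> real) \<Rightarrow> ('a \<Rightarrow> real) \<Rightarrow> real" where
  "L1_dist L f g = (LINT x|L. \<bar>f x - g x\<bar>)"

lemma L1_dist_commute: "L1_dist L f g = L1_dist L g f"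
  by (simp add: L1_dist_def abs_minus_commute)

lemma L1_dist_triangle:
  assumes [simp]: "integrable L f" "integrable L g" "integrable L k"
  shows "L1_dist L f k \<le> L1_dist L f g + L1_dist L g k"
  unfolding L1_dist_def
  by (subst Bochner_Integration.integral_add[symmetric])
    (auto simp del: Bochner_Integration.integral_add intro!: integral_mono)

lemma L1_dist_add_le:
  assumes [simp]: "integrable L f" "integrable L g" "integrable L f'" "integrable L g'"
  shows "L1_dist L (\<lambda>x. f x + g x) (\<lambda>x. f' x + g' x) \<le> L1_dist L f f' + L1_dist L g g'"
  unfolding L1_dist_def
  by (subst Bochner_Integration.integral_add[symmetric])
    (auto simp del: Bochner_Integration.integral_add intro!: integral_mono)

lemma L1_dist_cmult: "L1_dist L (\<lambda>x. c * f x) (\<lambda>x. c * g x) = \<bar>c\<bar> * L1_dist L f g"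
proof -
  have "\<bar>c * f x - c * g x\<bar> = \<bar>c\<bar> * \<bar>f x - g x\<bar>" for x
    by (metis abs_mult right_diff_distrib)
  then show ?thesis
    by (simp add: L1_dist_def)
qed

definition separable_sections ::
  "'b measure \<Rightarrow> 'a measure \<Rightarrow> ('b \<times> 'a \<Rightarrow> real) \<Rightarrow> bool" where
  "separable_sections R L F \<longleftrightarrow>
     (\<forall>y\<in>space R. integrable L (\<lambda>x. F (y, x))) \<and>
     (\<exists>D. countable D \<and> (\<forall>d\<in>D. integrable L d) \<and>
       (\<forall>y\<in>space R. \<forall>e>0. \<exists>d\<in>D. L1_dist L (\<lambda>x. F (y, x)) d < e))"

lemma separable_sectionsI:
  assumes "\<And>y. y \<in> space R \<Longrightarrow> integrable L (\<lambda>x. F (y, x))"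
    and "countable D" and "\<And>d. d \<in> D \<Longrightarrow> integrable L d"
    and "\<And>y e. y \<in> space R \<Longrightarrow> 0 < e \<Longrightarrow> \<exists>d\<in>D. L1_dist L (\<lambda>x. F (y, x)) d < e"
  shows "separable_sections R L F"
  unfolding separable_sections_def using assms by metis

lemma separable_sections_cong:
  assumes "\<And>y x. y \<in> space R \<Longrightarrow> x \<in> space L \<Longrightarrow> F (y, x) = G (y, x)"
    and "separable_sections R L F"
  shows "separable_sections R L G"
proof -
  have eq: "integrable L (\<lambda>x. F (y, x)) \<longleftrightarrow> integrable L (\<lambda>x. G (y, x))"
    "L1_dist L (\<lambda>x. F (y, x)) d = L1_dist L (\<lambda>x. G (y, x)) d"
    if "y \<in> space R" for y d
    unfolding L1_dist_def using assms(1)[OF that]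
    by (simp_all cong: Bochner_Integration.integrable_cong Bochner_Integration.integral_cong)
  obtain D where D: "countable D" "\<And>d. d \<in> D \<Longrightarrow> integrable L d"
      "\<And>y e. y \<in> space R \<Longrightarrow> 0 < e \<Longrightarrow> \<exists>d\<in>D. L1_dist L (\<lambda>x. F (y, x)) d < e"
    and F: "\<And>y. y \<in> space R \<Longrightarrow> integrable L (\<lambda>x. F (y, x))"
    using assms(2) unfolding separable_sections_def by metis
  show ?thesis
  proof (rule separable_sectionsI)
    show "integrable L (\<lambda>x. G (y, x))" if "y \<in> space R" for y
      using F[OF that] unfolding eq(1)[OF that] .
    show "\<exists>d\<in>D. L1_dist L (\<lambda>x. G (y, x)) d < e" if "y \<in> space R" "0 < e" for y e
      using D(3)[OF that] unfolding eq(2)[OF that(1)] .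
  qed (fact D(1,2))+
qed

lemma separable_sections_cmult:
  assumes "separable_sections R L F"
  shows "separable_sections R L (\<lambda>p. c * F p)"
proof -
  obtain D where D: "countable D" "\<And>d. d \<in> D \<Longrightarrow> integrable L d"
      "\<And>y e. y \<in> space R \<Longrightarrow> 0 < e \<Longrightarrow> \<exists>d\<in>D. L1_dist L (\<lambda>x. F (y, x)) d < e"
    and F: "\<And>y. y \<in> space R \<Longrightarrow> integrable L (\<lambda>x. F (y, x))"
    using assms unfolding separable_sections_def by metis
  show ?thesis
  proof (rule separable_sectionsI[where D = "(\<lambda>d x. c * d x) ` D"])
    fix y and e :: real
    assume y: "y \<in> space R" and "0 < e"
    then have "0 < e / (\<bar>c\<bar> + 1)"
      by (simp add: add_nonneg_pos)
    from D(3)[OF y this] obtain d where d: "d \<in> D" "L1_dist L (\<lambda>x. F (y, x)) d < e / (\<bar>c\<bar> + 1)"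
      by blast
    have "\<bar>c\<bar> * L1_dist L (\<lambda>x. F (y, x)) d \<le> \<bar>c\<bar> * (e / (\<bar>c\<bar> + 1))"
      using d by (intro mult_left_mono) auto
    also have "\<dots> < e"
      using \<open>0 < e\<close> by (simp add: field_simps add_nonneg_pos)
    finally show "\<exists>d\<in>(\<lambda>d x. c * d x) ` D. L1_dist L (\<lambda>x. c * F (y, x)) d < e"
      using d(1) by (auto simp: L1_dist_cmult)
  qed (use D(1,2) F in auto)
qed

lemma separable_sections_add:
  assumes "separable_sections R L F" and "separable_sections R L G"
  shows "separable_sections R L (\<lambda>p. F p + G p)"
proof -
  obtain D where D: "countable D" "\<And>d. d \<in> D \<Longrightarrow> integrable L d"
      "\<And>y e. y \<in> space R \<Longrightarrow> 0 < e \<Longrightarrow> \<exists>d\<in>D. L1_dist L (\<lambda>x. F (y, x)) d < e"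
    and F: "\<And>y. y \<in> space R \<Longrightarrow> integrable L (\<lambda>x. F (y, x))"
    using assms(1) unfolding separable_sections_def by metis
  obtain E where E: "countable E" "\<And>d. d \<in> E \<Longrightarrow> integrable L d"
      "\<And>y e. y \<in> space R \<Longrightarrow> 0 < e \<Longrightarrow> \<exists>d\<in>E. L1_dist L (\<lambda>x. G (y, x)) d < e"
    and G: "\<And>y. y \<in> space R \<Longrightarrow> integrable L (\<lambda>x. G (y, x))"
    using assms(2) unfolding separable_sections_def by metis
  show ?thesis
  proof (rule separable_sectionsI[where D = "(\<lambda>(d, d') x. d x + d' x) ` (D \<times> E)"])
    fix y and e :: real
    assume y: "y \<in> space R" and "0 < e"
    then obtain d d' where d: "d \<in> D" "L1_dist L (\<lambda>x. F (y, x)) d < e / 2"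
        and d': "d' \<in> E" "L1_dist L (\<lambda>x. G (y, x)) d' < e / 2"
      using D(3)[OF y, of "e / 2"] E(3)[OF y, of "e / 2"] by auto
    have "L1_dist L (\<lambda>x. F (y, x) + G (y, x)) (\<lambda>x. d x + d' x) < e"
      using L1_dist_add_le[OF F[OF y] G[OF y] D(2)[OF d(1)] E(2)[OF d'(1)]] d d' by linarith
    then show "\<exists>k\<in>(\<lambda>(d, d') x. d x + d' x) ` (D \<times> E).
        L1_dist L (\<lambda>x. F (y, x) + G (y, x)) k < e"
      using d(1) d'(1) by force
  qed (use D(1,2) E(1,2) F G in auto)
qed

lemma separable_sections_lim:
  assumes F: "\<And>y. y \<in> space R \<Longrightarrow> integrable L (\<lambda>x. F (y, x))"
    and G: "\<And>n. separable_sections R L (G n)"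
    and lim: "\<And>y. y \<in> space R \<Longrightarrow>
      (\<lambda>n. L1_dist L (\<lambda>x. G n (y, x)) (\<lambda>x. F (y, x))) \<longlonglongrightarrow> 0"
  shows "separable_sections R L F"
proof -
  have Gi: "integrable L (\<lambda>x. G n (y, x))" if "y \<in> space R" for n y
    using G that unfolding separable_sections_def by metis
  have "\<forall>n. \<exists>D. countable D \<and> (\<forall>d\<in>D. integrable L d) \<and>
       (\<forall>y\<in>space R. \<forall>e>0. \<exists>d\<in>D. L1_dist L (\<lambda>x. G n (y, x)) d < e)"
    using G unfolding separable_sections_def by metis
  then obtain D where D: "\<And>n. countable (D n)" "\<And>n d. d \<in> D n \<Longrightarrow> integrable L d"
      "\<And>n y e. y \<in> space R \<Longrightarrow> 0 < e \<Longrightarrow> \<exists>d\<in>D n. L1_dist L (\<lambda>x. G n (y, x)) d < e"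
    by metis
  show ?thesis
  proof (rule separable_sectionsI[where D = "\<Union>n. D n"])
    fix y and e :: real
    assume y: "y \<in> space R" and "0 < e"
    then have "\<forall>\<^sub>F n in sequentially. L1_dist L (\<lambda>x. G n (y, x)) (\<lambda>x. F (y, x)) < e / 2"
      using order_tendstoD(2)[OF lim[OF y], of "e / 2"] by simp
    then obtain n where n: "L1_dist L (\<lambda>x. G n (y, x)) (\<lambda>x. F (y, x)) < e / 2"
      by (auto simp: eventually_sequentially)
    obtain d where d: "d \<in> D n" "L1_dist L (\<lambda>x. G n (y, x)) d < e / 2"
      using D(3)[OF y, of "e / 2"] \<open>0 < e\<close> by auto
    have "L1_dist L (\<lambda>x. F (y, x)) d < e"
      using L1_dist_triangle[OF F[OF y] Gi[OF y, of n] D(2)[OF d(1)]] n d(2)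
      unfolding L1_dist_commute[of L "\<lambda>x. F (y, x)" "\<lambda>x. G n (y, x)"] by linarith
    then show "\<exists>d\<in>\<Union>n. D n. L1_dist L (\<lambda>x. F (y, x)) d < e"
      using d(1) by blast
  next
    show "countable (\<Union>n. D n)"
      using D(1) by (intro countable_UN) auto
    show "integrable L d" if "d \<in> (\<Union>n. D n)" for d
      using that D(2) by blast
  qed (fact F)
qed

lemma separable_sections_dominated:
  assumes F: "\<And>y. y \<in> space R \<Longrightarrow> integrable L (\<lambda>x. F (y, x))"
    and G: "\<And>n. separable_sections R L (G n)"
    and lim: "\<And>p. p \<in> space (R \<Otimes>\<^sub>M L) \<Longrightarrow> (\<lambda>n. G n p) \<longlonglongrightarrow> F p"
    and le: "\<And>n p. p \<in> space (R \<Otimes>\<^sub>M L) \<Longrightarrow> \<bar>G n p\<bar> \<le> F p"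
  shows "separable_sections R L F"
proof (rule separable_sections_lim[OF F G])
  fix y assume y: "y \<in> space R"
  have Gi: "integrable L (\<lambda>x. G n (y, x))" for n
    using G y unfolding separable_sections_def by metis
  have "(\<lambda>n. L1_dist L (\<lambda>x. G n (y, x)) (\<lambda>x. F (y, x))) \<longlonglongrightarrow> (LINT x|L. 0)"
    unfolding L1_dist_def
  proof (rule integral_dominated_convergence[where w = "\<lambda>x. 2 * F (y, x)"])
    show "AE x in L. (\<lambda>n. \<bar>G n (y, x) - F (y, x)\<bar>) \<longlonglongrightarrow> 0"
    proof (rule AE_I2)
      fix x assume "x \<in> space L"
      then have "(\<lambda>n. G n (y, x)) \<longlonglongrightarrow> F (y, x)"
        using y by (intro lim) (simp add: space_pair_measure)
      then show "(\<lambda>n. \<bar>G n (y, x) - F (y, x)\<bar>) \<longlonglongrightarrow> 0"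
        by (simp add: LIM_zero tendsto_rabs_zero)
    qed
    show "AE x in L. norm \<bar>G n (y, x) - F (y, x)\<bar> \<le> 2 * F (y, x)" for n
    proof (rule AE_I2)
      fix x assume "x \<in> space L"
      then have "\<bar>G n (y, x)\<bar> \<le> F (y, x)"
        using y by (intro le) (simp add: space_pair_measure)
      then show "norm \<bar>G n (y, x) - F (y, x)\<bar> \<le> 2 * F (y, x)"
        by auto
    qed
    show "(\<lambda>x. \<bar>G n (y, x) - F (y, x)\<bar>) \<in> borel_measurable L" for n
      using F[OF y] Gi[of n] by (intro borel_measurable_integrable) auto
    show "integrable L (\<lambda>x. 2 * F (y, x))"
      using F[OF y] by (rule integrable_mult_right)
  qed simp
  then show "(\<lambda>n. L1_dist L (\<lambda>x. G n (y, x)) (\<lambda>x. F (y, x))) \<longlonglongrightarrow> 0"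
    by simp
qed

lemma separable_sections_indicator_finite:
  assumes B: "B \<in> sets L" "emeasure L B \<noteq> \<infinity>" and A: "A \<in> sets (R \<Otimes>\<^sub>M L)"
  shows "separable_sections R L (\<lambda>p. indicator A p * indicator B (snd p))"
proof -
  have Bi: "integrable L (indicator B :: _ \<Rightarrow> real)"
    using B by (intro integrable_real_indicator) (auto simp: less_top)
  have sec: "integrable L (\<lambda>x. indicator A (y, x) * indicator B x :: real)"
    if A: "A \<in> sets (R \<Otimes>\<^sub>M L)" and y: "y \<in> space R" for A y
  proof (rule Bochner_Integration.integrable_bound[where f = "indicator B :: _ \<Rightarrow> real"])
    show "(\<lambda>x. indicator A (y, x) * indicator B x :: real) \<in> borel_measurable L"
      using A B y by measurable
    show "integrable L (indicator B :: _ \<Rightarrow> real)"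
      by (rule Bi)
  qed (auto simp: indicator_def)
  let ?G = "{a \<times> b | a b. a \<in> sets R \<and> b \<in> sets L}"
  have GP: "?G \<subseteq> Pow (space R \<times> space L)"
    by (rule pair_measure_closed)
  from A have "A \<in> sigma_sets (space R \<times> space L) ?G"
    by (simp add: sets_pair_measure)
  with Int_stable_pair_measure_generator GP show ?thesis
  proof (induction A rule: sigma_sets_induct_disjoint)
    case (basic A)
    then obtain a b where ab: "A = a \<times> b" "a \<in> sets R" "b \<in> sets L" by blast
    then have AM: "A \<in> sets (R \<Otimes>\<^sub>M L)" by simp
    show ?case
    proof (rule separable_sectionsI[where D = "{\<lambda>x. 0, \<lambda>x. indicator b x * indicator B x}"])
      fix d :: "_ \<Rightarrow> real" assume "d \<in> {\<lambda>x. 0, \<lambda>x. indicator b x * indicator B x}"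
      moreover have "integrable L (\<lambda>x. indicator b x * indicator B x :: real)"
        using B ab by (intro Bochner_Integration.integrable_bound[OF Bi]) (auto simp: indicator_def)
      ultimately show "integrable L d" by auto
    next
      fix y and e :: real assume "0 < e"
      then show "\<exists>d\<in>{\<lambda>x. 0, \<lambda>x. indicator b x * indicator B x}.
          L1_dist L (\<lambda>x. indicator A (y, x) * indicator B (snd (y, x))) d < e"
        by (cases "y \<in> a") (auto simp: ab L1_dist_def indicator_def)
    qed (use sec[OF AM] in auto)
  next
    case empty
    show ?case
      by (rule separable_sectionsI[where D = "{\<lambda>x. 0}"]) (auto simp: L1_dist_def)
  next
    case (compl A)
    have "separable_sections R L (\<lambda>p. indicator B (snd p))"
      using Bi by (intro separable_sectionsI[where D = "{indicator B}"]) (auto simp: L1_dist_def)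
    then have *: "separable_sections R L
        (\<lambda>p. indicator B (snd p) + (- 1) * (indicator A p * indicator B (snd p)))"
      using compl by (intro separable_sections_add separable_sections_cmult)
    show ?case
      by (rule separable_sections_cong[OF _ *]) (simp add: indicator_def)
  next
    case (union A)
    let ?U = "\<Union>i. A i"
    have AM: "A i \<in> sets (R \<Otimes>\<^sub>M L)" for i
      using union(2) by (auto simp: sets_pair_measure)
    then have UM: "?U \<in> sets (R \<Otimes>\<^sub>M L)"
      by (intro sets.countable_UN) auto
    have part: "separable_sections R L (\<lambda>p. (\<Sum>i<n. indicator (A i) p) * indicator B (snd p))" for n
    proof (induction n)
      case 0
      then show ?case
        by (intro separable_sectionsI[where D = "{\<lambda>x. 0}"]) (auto simp: L1_dist_def)
    next
      case (Suc n)
      from separable_sections_add[OF this union(3)[of n]] show ?case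
        by (simp add: distrib_right)
    qed
    show ?case
    proof (rule separable_sections_dominated[OF _ part])
      fix p
      have s: "(\<lambda>i. indicator (A i) p) sums (indicator ?U p :: real)"
        using union(1) by (intro indicator_sums) (auto simp: disjoint_family_on_def)
      then show "(\<lambda>n. (\<Sum>i<n. indicator (A i) p) * indicator B (snd p) :: real)
          \<longlonglongrightarrow> indicator ?U p * indicator B (snd p)"
        unfolding sums_def by (intro tendsto_mult_right)
      have "(\<Sum>i<n. indicator (A i) p) \<le> (indicator ?U p :: real)" for n
        using s sum_le_suminf[of "\<lambda>i. indicator (A i) p :: real" "{..<n}"]
        by (simp add: sums_iff)
      then show "\<bar>(\<Sum>i<n. indicator (A i) p) * indicator B (snd p)\<bar>
          \<le> (indicator ?U p * indicator B (snd p) :: real)" for n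
        by (simp add: abs_mult sum_nonneg mult_right_mono)
    next
      fix y assume "y \<in> space R"
      then show "integrable L (\<lambda>x. indicator ?U (y, x) * indicator B (snd (y, x)) :: real)"
        unfolding snd_conv by (rule sec[OF UM])
    qed
  qed
qed

lemma (in sigma_finite_measure) separable_sections_nonneg:
  assumes "F \<in> borel_measurable (R \<Otimes>\<^sub>M M)" and "\<And>p. 0 \<le> F p"
    and "\<And>y. y \<in> space R \<Longrightarrow> integrable M (\<lambda>x. F (y, x))"
  shows "separable_sections R M F"
  using assms
proof (induction rule: borel_measurable_induct_real)
  case (set A)
  obtain B :: "nat \<Rightarrow> _" where B: "range B \<subseteq> sets M" "(\<Union>i. B i) = space M"
    "\<And>i. emeasure M (B i) \<noteq> \<infinity>" "incseq B"
    using sigma_finite_incseq by blast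
  show ?case
  proof (rule separable_sections_dominated)
    show "separable_sections R M (\<lambda>p. indicator A p * indicator (B n) (snd p))" for n
      using B set by (intro separable_sections_indicator_finite) auto
    fix p assume p: "p \<in> space (R \<Otimes>\<^sub>M M)"
    then have "(\<lambda>n. indicator (B n) (snd p)) \<longlonglongrightarrow> (indicator (\<Union>i. B i) (snd p) :: real)"
      using B(4) by (intro LIMSEQ_indicator_incseq)
    then have "(\<lambda>n. indicator A p * indicator (B n) (snd p))
        \<longlonglongrightarrow> (indicator A p * indicator (\<Union>i. B i) (snd p) :: real)"
      by (intro tendsto_mult_left)
    then show "(\<lambda>n. indicator A p * indicator (B n) (snd p)) \<longlonglongrightarrow> (indicator A p :: real)"
      using p by (cases "p \<in> A") (auto simp: B(2) space_pair_measure)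
  qed (use set in \<open>auto simp: indicator_def\<close>)
next
  case (mult u c)
  show ?case
  proof (cases "c = 0")
    case True
    then show ?thesis
      by (intro separable_sectionsI[where D = "{\<lambda>x. 0}"]) (auto simp: L1_dist_def)
  next
    case False
    then have "integrable M (\<lambda>x. u (y, x))" if "y \<in> space R" for y
      using mult.prems[OF that] by simp
    then show ?thesis
      by (intro separable_sections_cmult mult.IH)
  qed
next
  case (add u v)
  have *: "integrable M (\<lambda>x. v (y, x))" "integrable M (\<lambda>x. u (y, x))" if "y \<in> space R" for y
    using add.hyps that
    by (auto intro!: Bochner_Integration.integrable_bound[OF add.prems[OF that]])
  show ?case
    by (intro separable_sections_add add.IH *)
next
  case (seq U)
  have le: "U n p \<le> F p" if "p \<in> space (R \<Otimes>\<^sub>M M)" for n p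
  proof (rule incseq_le)
    show "incseq (\<lambda>n. U n p)"
      using seq.hyps(3) unfolding incseq_def le_fun_def by blast
    show "(\<lambda>n. U n p) \<longlonglongrightarrow> F p"
      using that by (rule seq.hyps(4))
  qed
  show ?case
  proof (rule separable_sections_dominated[where G = U])
    fix n
    have "integrable M (\<lambda>x. U n (y, x))" if y: "y \<in> space R" for y
      using seq.hyps(1,2) y le
      by (intro Bochner_Integration.integrable_bound[OF seq.prems[OF y]])
        (auto simp: space_pair_measure intro!: order_trans[OF _ abs_ge_self])
    then show "separable_sections R M (U n)"
      by (rule seq.IH)
  next
    show "\<bar>U n p\<bar> \<le> F p" if "p \<in> space (R \<Otimes>\<^sub>M M)" for n p
      using le[OF that, of n] seq.hyps(2)[of n p] by linarith
  qed (fact seq.prems seq.hyps(4))+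
qed

lemma (in sigma_finite_measure) borel_measurable_L1_contraction:
  assumes F: "F \<in> borel_measurable (R \<Otimes>\<^sub>M M)" "\<And>p. 0 \<le> F p"
      "\<And>y. y \<in> space R \<Longrightarrow> integrable M (\<lambda>x. F (y, x))"
    and v: "\<And>y y'. y \<in> space R \<Longrightarrow> y' \<in> space R \<Longrightarrow>
      \<bar>v y - v y'\<bar> \<le> L1_dist M (\<lambda>x. F (y, x)) (\<lambda>x. F (y', x))"
  shows "v \<in> borel_measurable R"
proof -
  obtain D where D: "countable D" "\<And>d. d \<in> D \<Longrightarrow> integrable M d"
      "\<And>y e. y \<in> space R \<Longrightarrow> 0 < e \<Longrightarrow> \<exists>d\<in>D. L1_dist M (\<lambda>x. F (y, x)) d < e"
    using separable_sections_nonneg[OF F] unfolding separable_sections_def by metis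
  define near where "near d n y \<longleftrightarrow> y \<in> space R \<and> L1_dist M (\<lambda>x. F (y, x)) d < 1 / Suc n"
    for d and n :: nat and y
  define I where "I = {(d, n). d \<in> D \<and> (\<exists>y. near d n y)}"
  define c where "c = (\<lambda>(d, n). SOME y. near d n y)"
  have c: "near d n (c (d, n))" if "(d, n) \<in> I" for d n
    using that unfolding I_def c_def by (auto intro: someI_ex)
  have countI: "countable I"
    by (rule countable_subset[of _ "D \<times> UNIV"]) (use D(1) in \<open>auto simp: I_def\<close>)
  have c_space: "c i \<in> space R" if "i \<in> I" for i
    using c that unfolding near_def by (cases i) auto
  have dense: "\<exists>i\<in>I. L1_dist M (\<lambda>x. F (y, x)) (\<lambda>x. F (c i, x)) < e"
    if y: "y \<in> space R" and "0 < e" for y e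
  proof -
    obtain n :: nat where n: "1 / Suc n < e / 2"
      using \<open>0 < e\<close> nat_approx_posE[of "e / 2"] by auto
    obtain d where d: "d \<in> D" "L1_dist M (\<lambda>x. F (y, x)) d < 1 / Suc n"
      using D(3)[OF y, of "1 / Suc n"] by auto
    then have "(d, n) \<in> I"
      using y unfolding I_def near_def by auto
    from c[OF this] have "L1_dist M d (\<lambda>x. F (c (d, n), x)) < 1 / Suc n" "c (d, n) \<in> space R"
      by (auto simp: near_def L1_dist_commute)
    with L1_dist_triangle[OF F(3)[OF y] D(2)[OF d(1)] F(3)[OF this(2)]] d n
    show ?thesis
      by (intro bexI[OF _ \<open>(d, n) \<in> I\<close>]) linarith
  qed
  have dist_meas: "(\<lambda>y. L1_dist M (\<lambda>x. F (y, x)) (\<lambda>x. F (y', x))) \<in> borel_measurable R"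
    if "y' \<in> space R" for y'
    unfolding L1_dist_def using F(1) that by measurable
  show ?thesis
    unfolding borel_measurable_iff_less
  proof
    fix a
    have "{y \<in> space R. v y < a} =
      (\<Union>i\<in>I. {y \<in> space R. v (c i) + L1_dist M (\<lambda>x. F (y, x)) (\<lambda>x. F (c i, x)) < a})"
      (is "?l = ?r")
    proof (intro set_eqI iffI)
      fix y assume "y \<in> ?r"
      then obtain i where "i \<in> I" "y \<in> space R"
          "v (c i) + L1_dist M (\<lambda>x. F (y, x)) (\<lambda>x. F (c i, x)) < a" by auto
      with v[of y "c i"] c_space[of i] show "y \<in> ?l" by auto
    next
      fix y assume y: "y \<in> ?l"
      with dense[of y "(a - v y) / 2"] obtain i where
        i: "i \<in> I" "L1_dist M (\<lambda>x. F (y, x)) (\<lambda>x. F (c i, x)) < (a - v y) / 2" by auto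
      with y v[of y "c i"] c_space[of i] have
        "v (c i) + L1_dist M (\<lambda>x. F (y, x)) (\<lambda>x. F (c i, x)) < a"
        by (simp add: abs_le_iff)
      with i y show "y \<in> ?r" by auto
    qed
    also have "\<dots> \<in> sets R"
      using countI dist_meas[OF c_space]
      by (intro sets.countable_UN') (auto intro!: borel_measurable_less)
    finally show "{y \<in> space R. v y < a} \<in> sets R" .
  qed
qed

section \<open>The state space and the prediction operator\<close>

lemma borel_measurable_extend_zero:
  assumes X: "X \<in> sets M" and f: "f \<in> borel_measurable (N \<Otimes>\<^sub>M restrict_space M X)"
  shows "(\<lambda>p. indicator X (snd p) * f p :: real) \<in> borel_measurable (N \<Otimes>\<^sub>M M)"
proof -
  let ?S = "{p \<in> space (N \<Otimes>\<^sub>M M). snd p \<in> X}"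
  have S: "?S \<in> sets (N \<Otimes>\<^sub>M M)"
    using X by measurable
  have "(\<lambda>p. (fst p, snd p)) \<in> restrict_space (N \<Otimes>\<^sub>M M) ?S \<rightarrow>\<^sub>M N \<Otimes>\<^sub>M restrict_space M X"
    by (intro measurable_Pair measurable_restrict_space2 measurable_restrict_space1)
      (auto simp: space_restrict_space)
  then have "f \<in> borel_measurable (restrict_space (N \<Otimes>\<^sub>M M) ?S)"
    using f by (intro measurable_compose[OF _ f]) simp
  then have "(\<lambda>p. indicator ?S p *\<^sub>R f p) \<in> borel_measurable (N \<Otimes>\<^sub>M M)"
    using S by (subst borel_measurable_restrict_space_iff[symmetric]) auto
  then show ?thesis
    by (rule measurable_cong[THEN iffD1, rotated]) (auto simp: indicator_def)
qed

definition states :: "((real ^ 'n) \<times> 'q :: finite) measure" where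
  "states = lborel \<Otimes>\<^sub>M count_space UNIV"

lemma space_states [simp]: "space states = UNIV"
  by (simp add: states_def space_pair_measure)

lemma sets_states [measurable_cong]: "sets states = sets (borel \<Otimes>\<^sub>M count_space UNIV)"
  unfolding states_def by (intro sets_pair_measure_cong) auto

lemma sigma_finite_count_UNIV: "sigma_finite_measure (count_space (UNIV :: 'q :: finite set))"
  by (rule sigma_finite_measure_count_space_finite) simp

lemma sigma_finite_uniform_count_measure:
  "sigma_finite_measure (uniform_count_measure (UNIV :: 'a :: finite set))"
  by (intro finite_measure.axioms(1) finite_measureI)
    (simp add: emeasure_uniform_count_measure space_uniform_count_measure)

lemma nn_integral_uniform_count_measure:
  fixes f :: "'a :: finite \<Rightarrow> real"
  assumes "\<And>a. 0 \<le> f a"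
  shows "(\<integral>\<^sup>+ a. ennreal (real CARD('a) * f a) \<partial>uniform_count_measure UNIV) = (\<Sum>a\<in>UNIV. ennreal (f a))"
  unfolding uniform_count_measure_def using assms
  by (subst nn_integral_point_measure_finite)
    (auto simp: ennreal_mult[symmetric] simp del: sum_ennreal intro!: sum.cong)

lemma sigma_finite_states: "sigma_finite_measure (states :: ((real ^ 'n) \<times> 'q :: finite) measure)"
  unfolding states_def
  by (intro sigma_finite_pair_measure sigma_finite_count_UNIV sigma_finite_lborel)

interpretation states: sigma_finite_measure states
  by (rule sigma_finite_states)

lemma nn_integral_states:
  fixes f :: "(real ^ 'n) \<times> 'q :: finite \<Rightarrow> ennreal"
  assumes "f \<in> borel_measurable states"
  shows "(\<integral>\<^sup>+ s. f s \<partial>states) = (\<Sum>q\<in>UNIV. \<integral>\<^sup>+ x. f (x, q) \<partial>lborel)"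
proof -
  interpret pair_sigma_finite "lborel :: (real ^ 'n) measure" "count_space (UNIV :: 'q set)"
    by (intro pair_sigma_finite.intro sigma_finite_lborel sigma_finite_count_UNIV)
  show ?thesis
    using nn_integral_snd[of f] assms
    by (simp add: states_def nn_integral_count_space_finite)
qed

lemma measurable_states_section:
  "f \<in> borel_measurable states \<Longrightarrow> (\<lambda>x. f (x, q)) \<in> borel_measurable lborel"
  unfolding states_def by (rule measurable_compose[OF measurable_Pair2']) simp_all

lemma integrable_states_iff:
  fixes f :: "(real ^ 'n) \<times> 'q :: finite \<Rightarrow> real"
  shows "integrable states f \<longleftrightarrow> (\<forall>q. integrable lborel (\<lambda>x. f (x, q)))"
proof -
  have meas: "f \<in> borel_measurable states"
    if "\<And>q. (\<lambda>x. f (x, q)) \<in> borel_measurable lborel"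
  proof -
    have "(\<lambda>s. f (fst s, snd s)) \<in> borel_measurable states"
    proof (rule measurable_compose_countable'[where I = UNIV and f = "\<lambda>q s. f (fst s, q)"])
      show "(\<lambda>s. f (fst s, q)) \<in> borel_measurable states" for q
        by (rule measurable_compose[of fst _ lborel, OF _ that]) (simp add: states_def)
    qed (auto simp: states_def countable_finite)
    then show ?thesis by simp
  qed
  have fin: "(\<integral>\<^sup>+ s. ennreal (norm (f s)) \<partial>states) < \<infinity> \<longleftrightarrow>
      (\<forall>q. (\<integral>\<^sup>+ x. ennreal (norm (f (x, q))) \<partial>lborel) < \<infinity>)"
    if "f \<in> borel_measurable states"
    using that by (subst nn_integral_states) auto
  show ?thesis
    unfolding integrable_iff_bounded using meas fin measurable_states_section[of f] by blast
qed

lemma integral_states: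
  fixes f :: "(real ^ 'n) \<times> 'q :: finite \<Rightarrow> real"
  assumes "integrable states f"
  shows "(LINT s|states. f s) = (\<Sum>q\<in>UNIV. LINT x|lborel. f (x, q))"
proof -
  interpret pair_sigma_finite "lborel :: (real ^ 'n) measure" "count_space (UNIV :: 'q set)"
    by (intro pair_sigma_finite.intro sigma_finite_lborel sigma_finite_count_UNIV)
  show ?thesis
    using integral_snd[of "\<lambda>x q. f (x, q)"] assms
    by (simp add: states_def lebesgue_integral_count_space_finite)
qed

context hybrid_system
begin

definition kernel :: "'u \<Rightarrow> (real ^ 'n) \<times> 'q \<Rightarrow> (real ^ 'n) \<times> 'q \<Rightarrow> real" where
  "kernel u s' s = indicator K s * tau (fst s') (snd s') (fst s) (snd s) u"

definition predict :: "'u \<Rightarrow> ((real ^ 'n) \<times> 'q \<Rightarrow> real) \<Rightarrow> (real ^ 'n) \<times> 'q \<Rightarrow> real" where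
  "predict u \<sigma> s' = (\<Sum>q\<in>UNIV. LINT x|lborel. kernel u s' (x, q) * \<sigma> (x, q))"

definition mass :: "((real ^ 'n) \<times> 'q \<Rightarrow> real) \<Rightarrow> real" where
  "mass \<sigma> = (LINT s|states. \<sigma> s)"

lemma sufficient_statistic_iff:
  "sufficient_statistic \<sigma> \<longleftrightarrow>
     (\<forall>s. 0 \<le> \<sigma> s) \<and> (\<forall>x q. x \<notin> X \<longrightarrow> \<sigma> (x, q) = 0) \<and> integrable states \<sigma>"
  by (simp add: sufficient_statistic_def integrable_states_iff)

lemma sufficient_statisticD:
  assumes "sufficient_statistic \<sigma>"
  shows "0 \<le> \<sigma> s" "x \<notin> X \<Longrightarrow> \<sigma> (x, q) = 0" "integrable states \<sigma>"
  using assms unfolding sufficient_statistic_iff by blast+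

lemma sufficient_statistic_comb:
  assumes "sufficient_statistic \<sigma>1" "sufficient_statistic \<sigma>2" "0 \<le> a" "0 \<le> b"
  shows "sufficient_statistic (\<lambda>s. a * \<sigma>1 s + b * \<sigma>2 s)"
  using assms unfolding sufficient_statistic_iff by auto

lemma sufficient_statistic_abs_diff:
  assumes "sufficient_statistic \<sigma>1" "sufficient_statistic \<sigma>2"
  shows "sufficient_statistic (\<lambda>s. \<bar>\<sigma>1 s - \<sigma>2 s\<bar>)"
  using assms unfolding sufficient_statistic_iff by auto

lemma mass_nonneg: "sufficient_statistic \<sigma> \<Longrightarrow> 0 \<le> mass \<sigma>"
  unfolding mass_def by (simp add: sufficient_statisticD)

lemma nn_integral_eq_mass:
  assumes "sufficient_statistic \<sigma>"
  shows "(\<integral>\<^sup>+ s. ennreal (\<sigma> s) \<partial>states) = ennreal (mass \<sigma>)"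
  unfolding mass_def
  using sufficient_statisticD[OF assms] by (intro nn_integral_eq_integral) auto

lemma kernel_nonneg: "u \<in> U \<Longrightarrow> 0 \<le> kernel u s' s"
  using K_subset Tx_nonneg Tq_nonneg
  by (cases s) (auto simp: kernel_def tau_def indicator_def)

lemma kernel_measurable:
  assumes u: "u \<in> U"
  shows "(\<lambda>(s', s). kernel u s' s) \<in> borel_measurable (states \<Otimes>\<^sub>M states)"
proof -
  have Xm: "X \<in> sets borel" by (rule X_borel)
  have u': "u \<in> space (restrict_space borel U)"
    using u by (simp add: space_restrict_space)
  have "(\<lambda>(x', x). Tx x' x u q') \<in> borel_measurable (borel \<Otimes>\<^sub>M restrict_space borel X)" for q'
  proof -
    have "(\<lambda>p. (fst p, snd p, u)) \<in> borel \<Otimes>\<^sub>M restrict_space borel X \<rightarrow>\<^sub>M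
        borel \<Otimes>\<^sub>M restrict_space borel X \<Otimes>\<^sub>M restrict_space borel U"
      using u' by measurable
    from measurable_compose[OF this Tx_measurable[of q']] show ?thesis
      by (simp add: case_prod_beta)
  qed
  from borel_measurable_extend_zero[OF Xm this]
  have Tx': "(\<lambda>p. indicator X (snd p) * Tx (fst p) (snd p) u q')
      \<in> borel_measurable (borel \<Otimes>\<^sub>M borel)" for q'
    by (simp add: case_prod_beta)
  have "(\<lambda>x. Tq q' x q u) \<in> borel_measurable (restrict_space borel X)" for q q'
  proof -
    have "(\<lambda>x. (x, u)) \<in> restrict_space borel X \<rightarrow>\<^sub>M restrict_space borel X \<Otimes>\<^sub>M restrict_space borel U"
      using u' by measurable
    from measurable_compose[OF this Tq_measurable[of q' q]] show ?thesis
      by simp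
  qed
  then have Tq': "(\<lambda>x. indicator X x * Tq q' x q u) \<in> borel_measurable borel" for q q'
    using Xm by (subst (asm) borel_measurable_restrict_space_iff) auto
  have K': "K \<in> sets states"
    using K_borel by (simp add: sets_states)
  define g where "g = (\<lambda>(q', q) (p :: ((real ^ 'n) \<times> 'q) \<times> ((real ^ 'n) \<times> 'q)). indicator K (snd p) *
      ((indicator X (fst (snd p)) * Tx (fst (fst p)) (fst (snd p)) u q') *
       (indicator X (fst (snd p)) * Tq q' (fst (snd p)) q u)))"
  have "g (q', q) \<in> borel_measurable (states \<Otimes>\<^sub>M (states :: ((real ^ 'n) \<times> 'q) measure))" for q q'
    unfolding g_def prod.case
  proof (rule borel_measurable_times[OF _ borel_measurable_times])
    show "(\<lambda>p. indicator K (snd p) :: real) \<in> borel_measurable (states \<Otimes>\<^sub>M states)"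
      using K' by measurable
    have "(\<lambda>p. (fst (fst p), fst (snd p))) \<in>
        states \<Otimes>\<^sub>M states \<rightarrow>\<^sub>M (borel \<Otimes>\<^sub>M borel :: ((real ^ 'n) \<times> (real ^ 'n)) measure)"
      by measurable
    from measurable_compose[OF this Tx'[of q']]
    show "(\<lambda>p. indicator X (fst (snd p)) * Tx (fst (fst p)) (fst (snd p)) u q')
        \<in> borel_measurable (states \<Otimes>\<^sub>M states)"
      by simp
    have "(\<lambda>p. fst (snd p)) \<in> states \<Otimes>\<^sub>M states \<rightarrow>\<^sub>M (borel :: (real ^ 'n) measure)"
      by measurable
    from measurable_compose[OF this Tq'[of q' q]]
    show "(\<lambda>p. indicator X (fst (snd p)) * Tq q' (fst (snd p)) q u)
        \<in> borel_measurable (states \<Otimes>\<^sub>M states)"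
      by simp
  qed
  then have g: "g i \<in> borel_measurable (states \<Otimes>\<^sub>M (states :: ((real ^ 'n) \<times> 'q) measure))" for i
    by (cases i) auto
  have modes: "(\<lambda>p. (snd (fst p), snd (snd p))) \<in>
      states \<Otimes>\<^sub>M states \<rightarrow>\<^sub>M (count_space UNIV :: ('q \<times> 'q) measure)"
  proof -
    have "count_space UNIV \<Otimes>\<^sub>M count_space UNIV = (count_space UNIV :: ('q \<times> 'q) measure)"
      by (simp add: pair_measure_countable)
    moreover have "(\<lambda>p. (snd (fst p), snd (snd p))) \<in>
        states \<Otimes>\<^sub>M states \<rightarrow>\<^sub>M (count_space (UNIV :: 'q set) \<Otimes>\<^sub>M count_space (UNIV :: 'q set))"
      by measurable
    ultimately show ?thesis by simp
  qed
  have "(\<lambda>p. g (snd (fst p), snd (snd p)) p) \<in> borel_measurable (states \<Otimes>\<^sub>M states)"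
    by (rule measurable_compose_countable'[OF g modes]) simp
  moreover have "g (snd (fst p), snd (snd p)) p = (case p of (s', s) \<Rightarrow> kernel u s' s)" for p
    using K_subset by (cases p) (auto simp: g_def kernel_def tau_def indicator_def)
  ultimately show ?thesis by simp
qed

lemma kernel_measurable1:
  "u \<in> U \<Longrightarrow> (\<lambda>s'. kernel u s' s) \<in> borel_measurable states"
  using measurable_compose[OF measurable_Pair1'[of s states states] kernel_measurable]
  using measurable_compose[OF measurable_Pair2'[of s states states] kernel_measurable]
  by simp

lemma kernel_mass:
  assumes u: "u \<in> U"
  shows "(\<integral>\<^sup>+ s'. ennreal (kernel u s' s) \<partial>states) \<le> 1"
proof (cases "s \<in> K")
  case False
  then show ?thesis by (simp add: kernel_def)
next
  case True
  obtain x q where s: "s = (x, q)" by (cases s)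
  have x: "x \<in> X" using True K_subset s by auto
  have "(\<integral>\<^sup>+ x'. ennreal (kernel u (x', q') s) \<partial>lborel) = ennreal (Tq q' x q u)" for q'
  proof -
    have "(\<integral>\<^sup>+ x'. ennreal (Tx x' x u q' * Tq q' x q u) \<partial>lborel) = ennreal (1 * Tq q' x q u)"
      using Tx_density[OF x u, of q']
        Tx_nonneg[OF x u] Tq_nonneg[OF x u]
      by (subst nn_integral_eq_integral)
        (auto simp: has_bochner_integral_iff)
    then show ?thesis
      using True by (simp add: kernel_def tau_def s)
  qed
  then have "(\<integral>\<^sup>+ s'. ennreal (kernel u s' s) \<partial>states) = (\<Sum>q'\<in>UNIV. ennreal (Tq q' x q u))"
    using kernel_measurable1[OF u] by (subst nn_integral_states) auto
  also have "\<dots> = 1"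
    using Tq_nonneg[OF x u] Tq_sum[OF x u] by simp
  finally show ?thesis by simp
qed

lemma predict_nonneg: "u \<in> U \<Longrightarrow> sufficient_statistic \<sigma> \<Longrightarrow> 0 \<le> predict u \<sigma> s"
  unfolding predict_def
  by (intro sum_nonneg Bochner_Integration.integral_nonneg mult_nonneg_nonneg kernel_nonneg sufficient_statisticD(1))

lemma integrand_measurable:
  assumes "u \<in> U" "sufficient_statistic \<sigma>"
  shows "(\<lambda>(s', s). kernel u s' s * \<sigma> s) \<in> borel_measurable (states \<Otimes>\<^sub>M states)"
proof -
  have [measurable]: "\<sigma> \<in> borel_measurable states"
    using sufficient_statisticD(3)[OF assms(2)] by simp
  show ?thesis
    using kernel_measurable[OF assms(1)] by measurable
qed

lemma predict_measurable:
  assumes "u \<in> U" "sufficient_statistic \<sigma>"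
  shows "predict u \<sigma> \<in> borel_measurable states"
  unfolding predict_def
proof (intro borel_measurable_sum sigma_finite_measure.borel_measurable_lebesgue_integral
    sigma_finite_lborel)
  fix q :: 'q
  have "(\<lambda>p. (fst p, (snd p, q))) \<in> (states :: ((real ^ 'n) \<times> 'q) measure) \<Otimes>\<^sub>M lborel \<rightarrow>\<^sub>M states \<Otimes>\<^sub>M states"
    by measurable
  from measurable_compose[OF this integrand_measurable[OF assms]]
  show "(\<lambda>(s', x). kernel u s' (x, q) * \<sigma> (x, q)) \<in> borel_measurable (states \<Otimes>\<^sub>M lborel)"
    by (simp add: case_prod_beta)
qed

lemma pair_states: "pair_sigma_finite states states"
  by (intro pair_sigma_finite.intro sigma_finite_states)

lemma nn_integral_integrand:
  assumes u: "u \<in> U" and \<sigma>: "sufficient_statistic \<sigma>"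
  shows "(\<integral>\<^sup>+ s'. \<integral>\<^sup>+ s. ennreal (kernel u s' s * \<sigma> s) \<partial>states \<partial>states) \<le> ennreal (mass \<sigma>)"
proof -
  interpret pair_sigma_finite states states by (rule pair_states)
  have "(\<integral>\<^sup>+ s'. \<integral>\<^sup>+ s. ennreal (kernel u s' s * \<sigma> s) \<partial>states \<partial>states)
      = (\<integral>\<^sup>+ s. \<integral>\<^sup>+ s'. ennreal (kernel u s' s * \<sigma> s) \<partial>states \<partial>states)"
    using integrand_measurable[OF u \<sigma>] by (intro Fubini'[symmetric]) (simp add: case_prod_beta)
  also have "\<dots> = (\<integral>\<^sup>+ s. (\<integral>\<^sup>+ s'. ennreal (kernel u s' s) \<partial>states) * ennreal (\<sigma> s) \<partial>states)"
    using kernel_measurable1[OF u] kernel_nonneg[OF u] sufficient_statisticD(1)[OF \<sigma>]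
    by (intro nn_integral_cong) (simp add: ennreal_mult nn_integral_multc)
  also have "\<dots> \<le> (\<integral>\<^sup>+ s. 1 * ennreal (\<sigma> s) \<partial>states)"
    by (intro nn_integral_mono mult_right_mono kernel_mass u) simp
  finally show ?thesis
    by (simp add: nn_integral_eq_mass[OF \<sigma>])
qed

text \<open>
  Where an integral in \<open>predict\<close> diverges its value is the junk value 0, so linearity of
  \<open>predict\<close> in \<open>\<sigma>\<close> only holds almost everywhere.
\<close>

lemma predict_AE:
  assumes u: "u \<in> U" and \<sigma>: "sufficient_statistic \<sigma>"
  shows "AE s' in states. integrable states (\<lambda>s. kernel u s' s * \<sigma> s) \<and>
    predict u \<sigma> s' = (LINT s|states. kernel u s' s * \<sigma> s)"
proof -
  have m: "(\<lambda>s'. \<integral>\<^sup>+ s. ennreal (kernel u s' s * \<sigma> s) \<partial>states) \<in> borel_measurable states"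
    using measurable_compose[OF integrand_measurable[OF u \<sigma>] measurable_ennreal]
    by (intro states.borel_measurable_nn_integral) (simp add: case_prod_beta)
  have "(\<integral>\<^sup>+ s'. \<integral>\<^sup>+ s. ennreal (kernel u s' s * \<sigma> s) \<partial>states \<partial>states) \<noteq> \<infinity>"
    using nn_integral_integrand[OF u \<sigma>] by (auto simp: top_unique)
  from nn_integral_PInf_AE[OF m this] show ?thesis
  proof (rule AE_mp, intro AE_I2 impI)
    fix s' :: "(real ^ 'n) \<times> 'q"
    assume fin: "(\<integral>\<^sup>+ s. ennreal (kernel u s' s * \<sigma> s) \<partial>states) \<noteq> \<infinity>"
    have sec: "(\<lambda>s. kernel u s' s * \<sigma> s) \<in> borel_measurable states"
      using measurable_compose[OF measurable_Pair1'[of s' states states] integrand_measurable[OF u \<sigma>]]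
      by simp
    have "integrable states (\<lambda>s. kernel u s' s * \<sigma> s)"
      using sec fin kernel_nonneg[OF u] sufficient_statisticD(1)[OF \<sigma>]
      by (intro integrableI_nonneg) (auto simp: less_top)
    then show "integrable states (\<lambda>s. kernel u s' s * \<sigma> s) \<and>
        predict u \<sigma> s' = (LINT s|states. kernel u s' s * \<sigma> s)"
      by (simp add: integral_states predict_def)
  qed
qed

lemma predict_mass:
  assumes u: "u \<in> U" and \<sigma>: "sufficient_statistic \<sigma>"
  shows "(\<integral>\<^sup>+ s'. ennreal (predict u \<sigma> s') \<partial>states) \<le> ennreal (mass \<sigma>)"
proof -
  have "(\<integral>\<^sup>+ s'. ennreal (predict u \<sigma> s') \<partial>states)
      = (\<integral>\<^sup>+ s'. \<integral>\<^sup>+ s. ennreal (kernel u s' s * \<sigma> s) \<partial>states \<partial>states)"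
  proof (rule nn_integral_cong_AE, rule AE_mp[OF predict_AE[OF assms]], intro AE_I2 impI)
    fix s' :: "(real ^ 'n) \<times> 'q"
    assume "integrable states (\<lambda>s. kernel u s' s * \<sigma> s) \<and>
        predict u \<sigma> s' = (LINT s|states. kernel u s' s * \<sigma> s)"
    then show "ennreal (predict u \<sigma> s') = (\<integral>\<^sup>+ s. ennreal (kernel u s' s * \<sigma> s) \<partial>states)"
      using kernel_nonneg[OF u] sufficient_statisticD(1)[OF \<sigma>]
      by (subst nn_integral_eq_integral) auto
  qed
  then show ?thesis
    using nn_integral_integrand[OF assms] by simp
qed

lemma predict_comb:
  assumes u: "u \<in> U" and \<sigma>: "sufficient_statistic \<sigma>1" "sufficient_statistic \<sigma>2"
    and ab: "0 \<le> a" "0 \<le> b"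
  shows "AE s' in states. predict u (\<lambda>s. a * \<sigma>1 s + b * \<sigma>2 s) s' =
    a * predict u \<sigma>1 s' + b * predict u \<sigma>2 s'"
  using predict_AE[OF u \<sigma>(1)] predict_AE[OF u \<sigma>(2)]
    predict_AE[OF u sufficient_statistic_comb[OF \<sigma> ab]]
proof eventually_elim
  case (elim s')
  have "(LINT s|states. kernel u s' s * (a * \<sigma>1 s + b * \<sigma>2 s))
      = (LINT s|states. a * (kernel u s' s * \<sigma>1 s) + b * (kernel u s' s * \<sigma>2 s))"
    by (simp add: algebra_simps)
  also have "\<dots> = a * predict u \<sigma>1 s' + b * predict u \<sigma>2 s'"
    using elim by simp
  finally show ?case
    using elim by simp
qed

lemma predict_abs_diff:
  assumes u: "u \<in> U" and \<sigma>: "sufficient_statistic \<sigma>1" "sufficient_statistic \<sigma>2"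
  shows "AE s' in states. \<bar>predict u \<sigma>1 s' - predict u \<sigma>2 s'\<bar> \<le>
    predict u (\<lambda>s. \<bar>\<sigma>1 s - \<sigma>2 s\<bar>) s'"
  using predict_AE[OF u \<sigma>(1)] predict_AE[OF u \<sigma>(2)]
    predict_AE[OF u sufficient_statistic_abs_diff[OF \<sigma>]]
proof eventually_elim
  case (elim s')
  have "predict u \<sigma>1 s' - predict u \<sigma>2 s'
      = (LINT s|states. kernel u s' s * \<sigma>1 s - kernel u s' s * \<sigma>2 s)"
    using elim by simp
  also have "\<bar>\<dots>\<bar> \<le> (LINT s|states. \<bar>kernel u s' s * \<sigma>1 s - kernel u s' s * \<sigma>2 s\<bar>)"
    by (rule integral_abs_bound)
  also have "\<dots> = (LINT s|states. kernel u s' s * \<bar>\<sigma>1 s - \<sigma>2 s\<bar>)"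
    using kernel_nonneg[OF u]
    by (intro Bochner_Integration.integral_cong)
      (auto simp: abs_mult right_diff_distrib[symmetric])
  finally show ?case
    using elim by simp
qed

end

section \<open>The update operator and the value functions\<close>

locale observation_model = hybrid_system X U K Tx Tq Qo
  for X :: "(real ^ 'n) set"
    and U :: "'u :: polish_space set"
    and K :: "((real ^ 'n) \<times> 'q :: finite) set"
    and Tx :: "real ^ 'n \<Rightarrow> real ^ 'n \<Rightarrow> 'u \<Rightarrow> 'q \<Rightarrow> real"
    and Tq :: "'q \<Rightarrow> real ^ 'n \<Rightarrow> 'q \<Rightarrow> 'u \<Rightarrow> real"
    and Qo :: "'q \<Rightarrow> 'o :: finite \<Rightarrow> 'u \<Rightarrow> real" +
  fixes M :: "'y measure"
    and w :: "'y \<Rightarrow> real ^ 'n \<Rightarrow> 'u \<Rightarrow> real"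
  assumes M_sigma_finite: "sigma_finite_measure M"
    and w_measurable: "\<And>u. u \<in> U \<Longrightarrow>
          (\<lambda>(y, x). w y x u) \<in> borel_measurable (M \<Otimes>\<^sub>M restrict_space borel X)"
    and w_nonneg: "\<And>y x u. x \<in> X \<Longrightarrow> u \<in> U \<Longrightarrow> 0 \<le> w y x u"
    and w_mass: "\<And>x u. x \<in> X \<Longrightarrow> u \<in> U \<Longrightarrow> (\<integral>\<^sup>+ y. ennreal (w y x u) \<partial>M) = 1"
begin

definition likelihood :: "'u \<Rightarrow> 'y \<times> 'o \<Rightarrow> (real ^ 'n) \<times> 'q \<Rightarrow> real" where
  "likelihood u y s = real CARD('o) * Qo (snd s) (snd y) u * (indicator X (fst s) * w (fst y) (fst s) u)"

abbreviation R :: "('y \<times> 'o) measure" where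
  "R \<equiv> reference M"

lemma update_eq: "update w y u \<sigma> s = likelihood u y s * predict u \<sigma> s"
  by (cases y; cases s) (simp add: update_def likelihood_def predict_def kernel_def)

lemma sigma_finite_reference: "sigma_finite_measure R"
  unfolding reference_def
  by (intro sigma_finite_pair_measure M_sigma_finite sigma_finite_uniform_count_measure)

lemma pair_reference: "pair_sigma_finite R states"
  by (intro pair_sigma_finite.intro sigma_finite_states sigma_finite_reference)

lemma sets_reference: "sets R = sets (M \<Otimes>\<^sub>M count_space UNIV)"
  unfolding reference_def
  by (intro sets_pair_measure_cong) (auto simp: sets_uniform_count_measure)

lemma likelihood_nonneg: "u \<in> U \<Longrightarrow> 0 \<le> likelihood u y s"
  using Qo_nonneg w_nonneg by (auto simp: likelihood_def indicator_def)

lemma likelihood_measurable: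
  assumes u: "u \<in> U"
  shows "(\<lambda>(y, s). likelihood u y s) \<in> borel_measurable (R \<Otimes>\<^sub>M states)"
proof -
  note [measurable_cong] = sets_reference
  have w': "(\<lambda>p. indicator X (snd p) * w (fst p) (snd p) u) \<in> borel_measurable (M \<Otimes>\<^sub>M borel)"
    using borel_measurable_extend_zero[OF X_borel w_measurable[OF u]]
    by (simp add: case_prod_beta)
  have "(\<lambda>p. (fst (fst p), fst (snd p))) \<in>
      R \<Otimes>\<^sub>M (states :: ((real ^ 'n) \<times> 'q) measure) \<rightarrow>\<^sub>M M \<Otimes>\<^sub>M borel"
    by measurable
  from measurable_compose[OF this w']
  have 1: "(\<lambda>p. indicator X (fst (snd p)) * w (fst (fst p)) (fst (snd p)) u)
      \<in> borel_measurable (R \<Otimes>\<^sub>M (states :: ((real ^ 'n) \<times> 'q) measure))"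
    by simp
  have "(\<lambda>p. (snd (snd p), snd (fst p))) \<in>
      R \<Otimes>\<^sub>M (states :: ((real ^ 'n) \<times> 'q) measure) \<rightarrow>\<^sub>M count_space UNIV \<Otimes>\<^sub>M count_space UNIV"
    by measurable
  then have "(\<lambda>p. (snd (snd p), snd (fst p))) \<in>
      R \<Otimes>\<^sub>M (states :: ((real ^ 'n) \<times> 'q) measure) \<rightarrow>\<^sub>M count_space UNIV"
    by (simp add: pair_measure_countable)
  from measurable_compose[OF this borel_measurable_count_space[of "\<lambda>(q, yq). Qo q yq u"]]
  have "(\<lambda>p. Qo (snd (snd p)) (snd (fst p)) u)
      \<in> borel_measurable (R \<Otimes>\<^sub>M (states :: ((real ^ 'n) \<times> 'q) measure))"
    by simp
  then show ?thesis
    unfolding likelihood_def case_prod_beta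
    by (intro borel_measurable_times[OF _ 1]) (rule borel_measurable_times, simp)
qed

lemma likelihood_measurable1:
  "u \<in> U \<Longrightarrow> (\<lambda>y. likelihood u y s) \<in> borel_measurable R"
  using measurable_compose[OF measurable_Pair2'[of s states R] likelihood_measurable]
  by simp

lemma likelihood_mass:
  assumes u: "u \<in> U"
  shows "(\<integral>\<^sup>+ y. ennreal (likelihood u y s) \<partial>R) \<le> 1"
proof (cases "fst s \<in> X")
  case False
  then show ?thesis by (simp add: likelihood_def)
next
  case True
  obtain x q where s: "s = (x, q)" by (cases s)
  interpret pair_sigma_finite M "uniform_count_measure (UNIV :: 'o set)"
    by (intro pair_sigma_finite.intro M_sigma_finite sigma_finite_uniform_count_measure)
  have x: "x \<in> X" using True s by simp
  have wm: "(\<lambda>yx. w yx x u) \<in> borel_measurable M"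
    using measurable_compose[OF measurable_Pair2' w_measurable[OF u]] x
    by (simp add: space_restrict_space)
  have m: "(\<lambda>y. ennreal (likelihood u y s))
      \<in> borel_measurable (M \<Otimes>\<^sub>M uniform_count_measure (UNIV :: 'o set))"
    using likelihood_measurable1[OF u, of s] by (simp add: reference_def)
  have "(\<integral>\<^sup>+ y. ennreal (likelihood u y s) \<partial>R)
      = (\<integral>\<^sup>+ yq. \<integral>\<^sup>+ yx. ennreal (likelihood u (yx, yq) s) \<partial>M \<partial>uniform_count_measure UNIV)"
    using nn_integral_snd[OF m] by (simp add: reference_def)
  also have "\<dots> = (\<integral>\<^sup>+ yq. ennreal (real CARD('o) * Qo q yq u) \<partial>uniform_count_measure UNIV)"
  proof (rule nn_integral_cong)
    fix yq :: 'o
    have "(\<integral>\<^sup>+ yx. ennreal (likelihood u (yx, yq) s) \<partial>M)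
        = (\<integral>\<^sup>+ yx. ennreal (real CARD('o) * Qo q yq u) * ennreal (w yx x u) \<partial>M)"
      using x Qo_nonneg[OF u] w_nonneg[OF x u]
      by (intro nn_integral_cong) (simp add: likelihood_def s ennreal_mult)
    also have "\<dots> = ennreal (real CARD('o) * Qo q yq u)"
      using wm by (simp add: nn_integral_cmult w_mass[OF x u])
    finally show "(\<integral>\<^sup>+ yx. ennreal (likelihood u (yx, yq) s) \<partial>M)
        = ennreal (real CARD('o) * Qo q yq u)" .
  qed
  also have "\<dots> = (\<Sum>yq\<in>UNIV. ennreal (Qo q yq u))"
    by (intro nn_integral_uniform_count_measure Qo_nonneg u)
  also have "\<dots> = 1"
    using Qo_nonneg[OF u] Qo_sum[OF u] by simp
  finally show ?thesis by simp
qed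

lemma update_nonneg:
  "u \<in> U \<Longrightarrow> sufficient_statistic \<sigma> \<Longrightarrow> 0 \<le> update w y u \<sigma> s"
  by (simp add: update_eq likelihood_nonneg predict_nonneg)

lemma update_outside: "x \<notin> X \<Longrightarrow> update w y u \<sigma> (x, q) = 0"
  by (simp add: update_eq likelihood_def)

lemma update_measurable:
  assumes "u \<in> U" "sufficient_statistic \<sigma>"
  shows "(\<lambda>(y, s). update w y u \<sigma> s) \<in> borel_measurable (R \<Otimes>\<^sub>M states)"
proof -
  have "(\<lambda>p. predict u \<sigma> (snd p)) \<in> borel_measurable (R \<Otimes>\<^sub>M states)"
    using predict_measurable[OF assms] by measurable
  with likelihood_measurable[OF assms(1)] show ?thesis
    unfolding update_eq case_prod_beta by (rule borel_measurable_times)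
qed

lemma nn_integral_update:
  assumes u: "u \<in> U" and \<sigma>: "sufficient_statistic \<sigma>"
  shows "(\<integral>\<^sup>+ p. ennreal (case p of (y, s) \<Rightarrow> update w y u \<sigma> s) \<partial>(R \<Otimes>\<^sub>M states)) \<le> ennreal (mass \<sigma>)"
proof -
  interpret pair_sigma_finite R states by (rule pair_reference)
  have "(\<integral>\<^sup>+ p. ennreal (case p of (y, s) \<Rightarrow> update w y u \<sigma> s) \<partial>(R \<Otimes>\<^sub>M states))
      = (\<integral>\<^sup>+ s. \<integral>\<^sup>+ y. ennreal (update w y u \<sigma> s) \<partial>R \<partial>states)"
    using nn_integral_snd[OF measurable_compose[OF update_measurable[OF assms] measurable_ennreal]]
    by simp
  also have "\<dots> = (\<integral>\<^sup>+ s. (\<integral>\<^sup>+ y. ennreal (likelihood u y s) \<partial>R) * ennreal (predict u \<sigma> s) \<partial>states)"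
    using likelihood_measurable1[OF u] likelihood_nonneg[OF u] predict_nonneg[OF assms]
    by (intro nn_integral_cong) (simp add: update_eq ennreal_mult nn_integral_multc)
  also have "\<dots> \<le> (\<integral>\<^sup>+ s. 1 * ennreal (predict u \<sigma> s) \<partial>states)"
    by (intro nn_integral_mono mult_right_mono likelihood_mass u) simp
  also have "\<dots> \<le> ennreal (mass \<sigma>)"
    using predict_mass[OF assms] by simp
  finally show ?thesis .
qed

lemma update_integrable:
  assumes "u \<in> U" "sufficient_statistic \<sigma>"
  shows "integrable (R \<Otimes>\<^sub>M states) (\<lambda>(y, s). update w y u \<sigma> s)"
proof (rule integrableI_nonneg[OF update_measurable[OF assms]])
  show "(\<integral>\<^sup>+ p. ennreal (case p of (y, s) \<Rightarrow> update w y u \<sigma> s) \<partial>(R \<Otimes>\<^sub>M states)) < \<infinity>"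
    using nn_integral_update[OF assms] by (rule le_less_trans) simp
qed (auto simp: update_nonneg[OF assms])

lemma update_sufficient_statistic_iff:
  assumes "u \<in> U" "sufficient_statistic \<sigma>"
  shows "sufficient_statistic (update w y u \<sigma>) \<longleftrightarrow> integrable states (update w y u \<sigma>)"
  unfolding sufficient_statistic_iff using update_nonneg[OF assms] update_outside by blast

lemma AE_sufficient_statistic_update:
  assumes "u \<in> U" "sufficient_statistic \<sigma>"
  shows "AE y in R. sufficient_statistic (update w y u \<sigma>)"
proof -
  interpret pair_sigma_finite R states by (rule pair_reference)
  show ?thesis
    using AE_integrable_fst[OF update_integrable[OF assms]]
    by (simp add: update_sufficient_statistic_iff[OF assms])
qed

lemma mass_update_integrable:
  assumes "u \<in> U" "sufficient_statistic \<sigma>"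
  shows "integrable R (\<lambda>y. mass (update w y u \<sigma>))"
proof -
  interpret pair_sigma_finite R states by (rule pair_reference)
  show ?thesis
    using integrable_fst[OF update_integrable[OF assms]] by (simp add: mass_def)
qed

lemma mass_update_le:
  assumes "u \<in> U" "sufficient_statistic \<sigma>"
  shows "(LINT y|R. mass (update w y u \<sigma>)) \<le> mass \<sigma>"
proof -
  interpret pair_sigma_finite R states by (rule pair_reference)
  have "(LINT y|R. mass (update w y u \<sigma>))
      = (LINT p|(R \<Otimes>\<^sub>M states). (case p of (y, s) \<Rightarrow> update w y u \<sigma> s))"
    using integral_fst[OF update_integrable[OF assms]] by (simp add: mass_def)
  moreover have "ennreal (LINT p|(R \<Otimes>\<^sub>M states). (case p of (y, s) \<Rightarrow> update w y u \<sigma> s)) \<le> ennreal (mass \<sigma>)"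
    using nn_integral_update[OF assms] update_nonneg[OF assms]
    by (subst nn_integral_eq_integral[symmetric, OF update_integrable[OF assms]]) auto
  ultimately show ?thesis
    using mass_nonneg[OF assms(2)] by simp
qed

definition regular :: "(((real ^ 'n) \<times> 'q \<Rightarrow> real) \<Rightarrow> real) \<Rightarrow> bool" where
  "regular v \<longleftrightarrow>
     (\<forall>\<sigma>. \<not> sufficient_statistic \<sigma> \<longrightarrow> v \<sigma> = 0) \<and>
     (\<forall>\<sigma>. sufficient_statistic \<sigma> \<longrightarrow> 0 \<le> v \<sigma> \<and> v \<sigma> \<le> mass \<sigma>) \<and>
     (\<forall>\<sigma>1 \<sigma>2. sufficient_statistic \<sigma>1 \<longrightarrow> sufficient_statistic \<sigma>2 \<longrightarrow>
        \<bar>v \<sigma>1 - v \<sigma>2\<bar> \<le> L1_dist states \<sigma>1 \<sigma>2) \<and>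
     (\<forall>\<sigma>1 \<sigma>2 l. sufficient_statistic \<sigma>1 \<longrightarrow> sufficient_statistic \<sigma>2 \<longrightarrow> 0 \<le> l \<longrightarrow> l \<le> 1 \<longrightarrow>
        v (\<lambda>s. l * \<sigma>1 s + (1 - l) * \<sigma>2 s) \<le> l * v \<sigma>1 + (1 - l) * v \<sigma>2)"

context
  fixes v assumes v: "regular v"
begin

lemma v_outside: "\<not> sufficient_statistic \<sigma> \<Longrightarrow> v \<sigma> = 0"
  and v_nonneg: "sufficient_statistic \<sigma> \<Longrightarrow> 0 \<le> v \<sigma>"
  and v_le_mass: "sufficient_statistic \<sigma> \<Longrightarrow> v \<sigma> \<le> mass \<sigma>"
  and v_lipschitz: "sufficient_statistic \<sigma>1 \<Longrightarrow> sufficient_statistic \<sigma>2 \<Longrightarrow>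
        \<bar>v \<sigma>1 - v \<sigma>2\<bar> \<le> L1_dist states \<sigma>1 \<sigma>2"
  and v_convex: "sufficient_statistic \<sigma>1 \<Longrightarrow> sufficient_statistic \<sigma>2 \<Longrightarrow> 0 \<le> l \<Longrightarrow> l \<le> 1 \<Longrightarrow>
        v (\<lambda>s. l * \<sigma>1 s + (1 - l) * \<sigma>2 s) \<le> l * v \<sigma>1 + (1 - l) * v \<sigma>2"
  using v unfolding regular_def by blast+

lemma v_update_measurable:
  assumes "u \<in> U" "sufficient_statistic \<sigma>"
  shows "(\<lambda>y. v (update w y u \<sigma>)) \<in> borel_measurable R"
proof -
  note upd = update_measurable[OF assms]
  define good where "good y \<longleftrightarrow> integrable states (update w y u \<sigma>)" for y
  have good[measurable]: "Measurable.pred R good"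
    unfolding good_def
    using states.borel_measurable_lebesgue_integrable[OF upd] by simp
  define F where "F p = (if good (fst p) then update w (fst p) u \<sigma> (snd p) else 0)" for p
  have Fm: "F \<in> borel_measurable (R \<Otimes>\<^sub>M states)"
    unfolding F_def using upd unfolding case_prod_beta by measurable
  have ss: "sufficient_statistic (\<lambda>s. F (y, s))" for y
    using update_sufficient_statistic_iff[OF assms, of y]
    by (cases "good y") (auto simp: F_def good_def sufficient_statistic_def)
  have eq: "v (update w y u \<sigma>) = v (\<lambda>s. F (y, s))" for y
  proof (cases "good y")
    case True
    then show ?thesis by (simp add: F_def)
  next
    case False
    then have "v (update w y u \<sigma>) = 0"
      by (simp add: v_outside update_sufficient_statistic_iff[OF assms] good_def)
    moreover have "mass (\<lambda>s. F (y, s)) = 0"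
      using False by (simp add: F_def mass_def)
    with v_nonneg[OF ss[of y]] v_le_mass[OF ss[of y]] have "v (\<lambda>s. F (y, s)) = 0"
      by simp
    ultimately show ?thesis by simp
  qed
  have "(\<lambda>y. v (\<lambda>s. F (y, s))) \<in> borel_measurable R"
  proof (rule states.borel_measurable_L1_contraction[OF Fm])
    show "0 \<le> F p" for p
      using update_nonneg[OF assms] by (simp add: F_def)
    show "integrable states (\<lambda>s. F (y, s))" for y
      using sufficient_statisticD(3)[OF ss] .
    show "\<bar>v (\<lambda>s. F (y, s)) - v (\<lambda>s. F (y', s))\<bar>
        \<le> L1_dist states (\<lambda>s. F (y, s)) (\<lambda>s. F (y', s))" for y y'
      by (intro v_lipschitz ss)
  qed
  then show ?thesis
    by (simp add: eq)
qed

lemma v_update_bounds: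
  assumes "u \<in> U" "sufficient_statistic \<sigma>"
  shows "AE y in R. 0 \<le> v (update w y u \<sigma>) \<and> v (update w y u \<sigma>) \<le> mass (update w y u \<sigma>)"
  using AE_sufficient_statistic_update[OF assms]
  by eventually_elim (simp add: v_nonneg v_le_mass)

lemma v_update_integrable:
  assumes "u \<in> U" "sufficient_statistic \<sigma>"
  shows "integrable R (\<lambda>y. v (update w y u \<sigma>))"
proof (rule Bochner_Integration.integrable_bound[OF mass_update_integrable[OF assms]])
  show "AE y in R. norm (v (update w y u \<sigma>)) \<le> norm (mass (update w y u \<sigma>))"
    using v_update_bounds[OF assms] by eventually_elim simp
qed (rule v_update_measurable[OF assms])

definition expected :: "'u \<Rightarrow> ((real ^ 'n) \<times> 'q \<Rightarrow> real) \<Rightarrow> real" where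
  "expected u \<sigma> = (LINT y|R. v (update w y u \<sigma>))"

lemma expected_nonneg: "u \<in> U \<Longrightarrow> sufficient_statistic \<sigma> \<Longrightarrow> 0 \<le> expected u \<sigma>"
  unfolding expected_def using v_update_bounds by (intro integral_nonneg_AE) auto

lemma expected_le_mass:
  assumes "u \<in> U" "sufficient_statistic \<sigma>"
  shows "expected u \<sigma> \<le> mass \<sigma>"
proof -
  have "expected u \<sigma> \<le> (LINT y|R. mass (update w y u \<sigma>))"
    unfolding expected_def using v_update_bounds[OF assms]
    by (intro integral_mono_AE v_update_integrable mass_update_integrable assms) auto
  with mass_update_le[OF assms] show ?thesis by simp
qed

lemma expected_lipschitz:
  assumes u: "u \<in> U" and \<sigma>: "sufficient_statistic \<sigma>1" "sufficient_statistic \<sigma>2"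
  shows "\<bar>expected u \<sigma>1 - expected u \<sigma>2\<bar> \<le> L1_dist states \<sigma>1 \<sigma>2"
proof -
  let ?d = "\<lambda>s. \<bar>\<sigma>1 s - \<sigma>2 s\<bar>"
  have d: "sufficient_statistic ?d"
    by (rule sufficient_statistic_abs_diff[OF \<sigma>])
  have "expected u \<sigma>1 - expected u \<sigma>2 = (LINT y|R. v (update w y u \<sigma>1) - v (update w y u \<sigma>2))"
    unfolding expected_def
    by (intro Bochner_Integration.integral_diff[symmetric] v_update_integrable u \<sigma>)
  then have "\<bar>expected u \<sigma>1 - expected u \<sigma>2\<bar> \<le> (LINT y|R. \<bar>v (update w y u \<sigma>1) - v (update w y u \<sigma>2)\<bar>)"
    by (simp only: integral_abs_bound)
  also have "\<dots> \<le> (LINT y|R. mass (update w y u ?d))"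
  proof (rule integral_mono_AE)
    show "integrable R (\<lambda>y. \<bar>v (update w y u \<sigma>1) - v (update w y u \<sigma>2)\<bar>)"
      by (intro integrable_abs Bochner_Integration.integrable_diff v_update_integrable u \<sigma>)
    show "integrable R (\<lambda>y. mass (update w y u ?d))"
      by (rule mass_update_integrable[OF u d])
    show "AE y in R. \<bar>v (update w y u \<sigma>1) - v (update w y u \<sigma>2)\<bar> \<le> mass (update w y u ?d)"
      using AE_sufficient_statistic_update[OF u \<sigma>(1)] AE_sufficient_statistic_update[OF u \<sigma>(2)]
        AE_sufficient_statistic_update[OF u d]
    proof eventually_elim
      case (elim y)
      have "\<bar>v (update w y u \<sigma>1) - v (update w y u \<sigma>2)\<bar>
          \<le> L1_dist states (update w y u \<sigma>1) (update w y u \<sigma>2)"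
        using elim by (intro v_lipschitz)
      also have "\<dots> \<le> mass (update w y u ?d)"
        unfolding L1_dist_def mass_def
      proof (rule integral_mono_AE)
        show "AE s in states. \<bar>update w y u \<sigma>1 s - update w y u \<sigma>2 s\<bar> \<le> update w y u ?d s"
          using predict_abs_diff[OF u \<sigma>]
        proof eventually_elim
          case (elim s)
          have "\<bar>update w y u \<sigma>1 s - update w y u \<sigma>2 s\<bar>
              = likelihood u y s * \<bar>predict u \<sigma>1 s - predict u \<sigma>2 s\<bar>"
            unfolding update_eq right_diff_distrib[symmetric] abs_mult
            using likelihood_nonneg[OF u, of y s] by simp
          also have "\<dots> \<le> update w y u ?d s"
            unfolding update_eq by (intro mult_left_mono elim likelihood_nonneg u)
          finally show ?case .
        qed
        show "integrable states (\<lambda>s. \<bar>update w y u \<sigma>1 s - update w y u \<sigma>2 s\<bar>)"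
          by (intro integrable_abs Bochner_Integration.integrable_diff sufficient_statisticD(3) elim)
        show "integrable states (update w y u ?d)"
          by (intro sufficient_statisticD(3) elim)
      qed
      finally show ?case .
    qed
  qed
  also have "\<dots> \<le> L1_dist states \<sigma>1 \<sigma>2"
    using mass_update_le[OF u d] by (simp add: L1_dist_def mass_def)
  finally show ?thesis .
qed

lemma expected_convex:
  assumes u: "u \<in> U" and \<sigma>: "sufficient_statistic \<sigma>1" "sufficient_statistic \<sigma>2"
    and l: "0 \<le> l" "l \<le> 1"
  shows "expected u (\<lambda>s. l * \<sigma>1 s + (1 - l) * \<sigma>2 s) \<le> l * expected u \<sigma>1 + (1 - l) * expected u \<sigma>2"
proof -
  let ?c = "\<lambda>s. l * \<sigma>1 s + (1 - l) * \<sigma>2 s"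
  have c: "sufficient_statistic ?c"
    using l by (intro sufficient_statistic_comb \<sigma>) auto
  have "expected u ?c \<le> (LINT y|R. l * v (update w y u \<sigma>1) + (1 - l) * v (update w y u \<sigma>2))"
    unfolding expected_def
  proof (rule integral_mono_AE)
    show "integrable R (\<lambda>y. v (update w y u ?c))"
      by (rule v_update_integrable[OF u c])
    show "integrable R (\<lambda>y. l * v (update w y u \<sigma>1) + (1 - l) * v (update w y u \<sigma>2))"
      by (intro Bochner_Integration.integrable_add integrable_mult_right v_update_integrable u \<sigma>)
    show "AE y in R. v (update w y u ?c)
        \<le> l * v (update w y u \<sigma>1) + (1 - l) * v (update w y u \<sigma>2)"
      using AE_sufficient_statistic_update[OF u \<sigma>(1)] AE_sufficient_statistic_update[OF u \<sigma>(2)]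
        AE_sufficient_statistic_update[OF u c]
    proof eventually_elim
      case (elim y)
      let ?k = "\<lambda>s. l * update w y u \<sigma>1 s + (1 - l) * update w y u \<sigma>2 s"
      have k: "sufficient_statistic ?k"
        using l by (intro sufficient_statistic_comb elim) auto
      have "L1_dist states (update w y u ?c) ?k = 0"
        unfolding L1_dist_def
      proof (rule integral_eq_zero_AE)
        have "AE s in states. predict u ?c s = l * predict u \<sigma>1 s + (1 - l) * predict u \<sigma>2 s"
          using l by (intro predict_comb u \<sigma>) auto
        then have "AE s in states. update w y u ?c s = ?k s"
        proof eventually_elim
          case (elim s)
          then show ?case
            unfolding update_eq by (simp only: distrib_left mult.left_commute)
        qed
        then show "AE s in states. \<bar>update w y u ?c s - ?k s\<bar> = 0"
          by eventually_elim simp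
      qed
      then have "v (update w y u ?c) = v ?k"
        using v_lipschitz[OF elim(3) k] by simp
      also have "\<dots> \<le> l * v (update w y u \<sigma>1) + (1 - l) * v (update w y u \<sigma>2)"
        by (intro v_convex elim l)
      finally show ?case .
    qed
  qed
  also have "\<dots> = l * expected u \<sigma>1 + (1 - l) * expected u \<sigma>2"
    unfolding expected_def using v_update_integrable[OF u \<sigma>(1)] v_update_integrable[OF u \<sigma>(2)]
    by simp
  finally show ?thesis .
qed

lemma regular_step:
  "regular (\<lambda>\<sigma>. if \<not> sufficient_statistic \<sigma> then 0
     else SUP u\<in>U. LINT y|R. v (update w y u \<sigma>))"
proof -
  define V where "V \<sigma> = (SUP u\<in>U. expected u \<sigma>)" for \<sigma>
  have bdd: "bdd_above ((\<lambda>u. expected u \<sigma>) ` U)" if "sufficient_statistic \<sigma>" for \<sigma>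
    using expected_le_mass[OF _ that] by (intro bdd_aboveI2)
  have upper: "expected u \<sigma> \<le> V \<sigma>" if "u \<in> U" "sufficient_statistic \<sigma>" for u \<sigma>
    unfolding V_def using that bdd by (intro cSUP_upper)
  have least: "V \<sigma> \<le> b" if "\<And>u. u \<in> U \<Longrightarrow> expected u \<sigma> \<le> b" for \<sigma> b
    unfolding V_def using that U_nonempty by (intro cSUP_least)
  have nonneg: "0 \<le> V \<sigma>" if "sufficient_statistic \<sigma>" for \<sigma>
  proof -
    obtain u where "u \<in> U" using U_nonempty by blast
    then show ?thesis
      using expected_nonneg[of u \<sigma>] upper[of u \<sigma>] that by linarith
  qed
  have le: "V \<sigma>1 \<le> V \<sigma>2 + L1_dist states \<sigma>1 \<sigma>2"
    if "sufficient_statistic \<sigma>1" "sufficient_statistic \<sigma>2" for \<sigma>1 \<sigma>2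
  proof (rule least)
    fix u assume "u \<in> U"
    with expected_lipschitz[OF this that] upper[OF this that(2)]
    show "expected u \<sigma>1 \<le> V \<sigma>2 + L1_dist states \<sigma>1 \<sigma>2" by linarith
  qed
  have convex: "V (\<lambda>s. l * \<sigma>1 s + (1 - l) * \<sigma>2 s) \<le> l * V \<sigma>1 + (1 - l) * V \<sigma>2"
    if \<sigma>: "sufficient_statistic \<sigma>1" "sufficient_statistic \<sigma>2" and l: "0 \<le> l" "l \<le> 1" for \<sigma>1 \<sigma>2 l
  proof (rule least)
    fix u assume u: "u \<in> U"
    have "l * expected u \<sigma>1 + (1 - l) * expected u \<sigma>2 \<le> l * V \<sigma>1 + (1 - l) * V \<sigma>2"
      using l by (intro add_mono mult_left_mono upper u \<sigma>) auto
    with expected_convex[OF u \<sigma> l]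
    show "expected u (\<lambda>s. l * \<sigma>1 s + (1 - l) * \<sigma>2 s) \<le> l * V \<sigma>1 + (1 - l) * V \<sigma>2"
      by simp
  qed
  have "regular (\<lambda>\<sigma>. if \<not> sufficient_statistic \<sigma> then 0 else V \<sigma>)"
    unfolding regular_def
  proof (intro conjI allI impI)
    fix \<sigma>1 \<sigma>2
    assume \<sigma>: "sufficient_statistic \<sigma>1" "sufficient_statistic \<sigma>2"
    then show "\<bar>(if \<not> sufficient_statistic \<sigma>1 then 0 else V \<sigma>1)
        - (if \<not> sufficient_statistic \<sigma>2 then 0 else V \<sigma>2)\<bar> \<le> L1_dist states \<sigma>1 \<sigma>2"
      using le[OF \<sigma>] le[OF \<sigma>(2,1)] L1_dist_commute[of states \<sigma>1 \<sigma>2] by simp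
  next
    fix \<sigma>1 \<sigma>2 and l :: real
    assume \<sigma>: "sufficient_statistic \<sigma>1" "sufficient_statistic \<sigma>2" and l: "0 \<le> l" "l \<le> 1"
    then show "(if \<not> sufficient_statistic (\<lambda>s. l * \<sigma>1 s + (1 - l) * \<sigma>2 s) then 0
          else V (\<lambda>s. l * \<sigma>1 s + (1 - l) * \<sigma>2 s))
        \<le> l * (if \<not> sufficient_statistic \<sigma>1 then 0 else V \<sigma>1)
          + (1 - l) * (if \<not> sufficient_statistic \<sigma>2 then 0 else V \<sigma>2)"
      using convex[OF \<sigma> l] sufficient_statistic_comb[OF \<sigma>, of l "1 - l"] by simp
  qed (simp_all add: nonneg least expected_le_mass)
  then show ?thesis
    unfolding V_def expected_def .
qed

end

lemma pairing_K_eq: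
  assumes "sufficient_statistic \<sigma>"
  shows "pairing \<sigma> (indicator K) = (LINT s|states. \<sigma> s * indicator K s)"
    and "integrable states (\<lambda>s. \<sigma> s * indicator K s)"
proof -
  have "K \<in> sets states"
    using K_borel by (simp add: sets_states)
  then show int: "integrable states (\<lambda>s. \<sigma> s * indicator K s)"
    using sufficient_statisticD(3)[OF assms] by (rule integrable_real_mult_indicator)
  show "pairing \<sigma> (indicator K) = (LINT s|states. \<sigma> s * indicator K s)"
    using integral_states[OF int] by (simp add: pairing_def)
qed

lemma regular_pairing:
  "regular (\<lambda>\<sigma>. if \<not> sufficient_statistic \<sigma> then 0 else pairing \<sigma> (indicator K))"
proof -
  have nonneg: "0 \<le> pairing \<sigma> (indicator K)" if "sufficient_statistic \<sigma>" for \<sigma>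
    unfolding pairing_K_eq[OF that] using sufficient_statisticD(1)[OF that]
    by (intro Bochner_Integration.integral_nonneg) simp
  have le: "pairing \<sigma> (indicator K) \<le> mass \<sigma>" if "sufficient_statistic \<sigma>" for \<sigma>
    unfolding pairing_K_eq(1)[OF that] mass_def using sufficient_statisticD(1)[OF that]
    by (intro integral_mono pairing_K_eq that sufficient_statisticD) (simp add: indicator_def)
  have lipschitz: "\<bar>pairing \<sigma>1 (indicator K) - pairing \<sigma>2 (indicator K)\<bar> \<le> L1_dist states \<sigma>1 \<sigma>2"
    if \<sigma>: "sufficient_statistic \<sigma>1" "sufficient_statistic \<sigma>2" for \<sigma>1 \<sigma>2
  proof -
    have "pairing \<sigma>1 (indicator K) - pairing \<sigma>2 (indicator K)
        = (LINT s|states. \<sigma>1 s * indicator K s - \<sigma>2 s * indicator K s)"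
      unfolding pairing_K_eq(1)[OF \<sigma>(1)] pairing_K_eq(1)[OF \<sigma>(2)]
      by (intro Bochner_Integration.integral_diff[symmetric] pairing_K_eq \<sigma>)
    also have "\<bar>\<dots>\<bar> \<le> (LINT s|states. \<bar>\<sigma>1 s * indicator K s - \<sigma>2 s * indicator K s\<bar>)"
      by (rule integral_abs_bound)
    also have "\<dots> \<le> L1_dist states \<sigma>1 \<sigma>2"
      unfolding L1_dist_def
      by (intro integral_mono integrable_abs Bochner_Integration.integrable_diff pairing_K_eq \<sigma>
          sufficient_statisticD(3)) (simp add: indicator_def)
    finally show ?thesis .
  qed
  have affine: "pairing (\<lambda>s. l * \<sigma>1 s + (1 - l) * \<sigma>2 s) (indicator K)
      = l * pairing \<sigma>1 (indicator K) + (1 - l) * pairing \<sigma>2 (indicator K)"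
    if \<sigma>: "sufficient_statistic \<sigma>1" "sufficient_statistic \<sigma>2" and l: "0 \<le> l" "l \<le> 1" for \<sigma>1 \<sigma>2 l
  proof -
    have "sufficient_statistic (\<lambda>s. l * \<sigma>1 s + (1 - l) * \<sigma>2 s)"
      using l by (intro sufficient_statistic_comb \<sigma>) auto
    from pairing_K_eq(1)[OF this]
    have "pairing (\<lambda>s. l * \<sigma>1 s + (1 - l) * \<sigma>2 s) (indicator K)
        = (LINT s|states. l * (\<sigma>1 s * indicator K s) + (1 - l) * (\<sigma>2 s * indicator K s))"
      by (simp only: distrib_right mult.assoc)
    then show ?thesis
      using pairing_K_eq(2)[OF \<sigma>(1)] pairing_K_eq(2)[OF \<sigma>(2)]
      unfolding pairing_K_eq(1)[OF \<sigma>(1)] pairing_K_eq(1)[OF \<sigma>(2)] by simp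
  qed
  show ?thesis
    unfolding regular_def
  proof (intro conjI allI impI)
    fix \<sigma>1 \<sigma>2
    assume \<sigma>: "sufficient_statistic \<sigma>1" "sufficient_statistic \<sigma>2"
    then show "\<bar>(if \<not> sufficient_statistic \<sigma>1 then 0 else pairing \<sigma>1 (indicator K))
        - (if \<not> sufficient_statistic \<sigma>2 then 0 else pairing \<sigma>2 (indicator K))\<bar>
        \<le> L1_dist states \<sigma>1 \<sigma>2"
      using lipschitz[OF \<sigma>] by simp
  next
    fix \<sigma>1 \<sigma>2 and l :: real
    assume \<sigma>: "sufficient_statistic \<sigma>1" "sufficient_statistic \<sigma>2" and l: "0 \<le> l" "l \<le> 1"
    then show "(if \<not> sufficient_statistic (\<lambda>s. l * \<sigma>1 s + (1 - l) * \<sigma>2 s) then 0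
          else pairing (\<lambda>s. l * \<sigma>1 s + (1 - l) * \<sigma>2 s) (indicator K))
        \<le> l * (if \<not> sufficient_statistic \<sigma>1 then 0 else pairing \<sigma>1 (indicator K))
          + (1 - l) * (if \<not> sufficient_statistic \<sigma>2 then 0 else pairing \<sigma>2 (indicator K))"
      using affine[OF \<sigma> l] sufficient_statistic_comb[OF \<sigma>, of l "1 - l"] by simp
  qed (simp_all add: nonneg le)
qed

declare value_fun.simps [simp del]

lemma regular_value_fun: "regular (value_fun M w T t)"
proof (induction "T - t" arbitrary: t)
  case 0
  then have "value_fun M w T t =
      (\<lambda>\<sigma>. if \<not> sufficient_statistic \<sigma> then 0 else pairing \<sigma> (indicator K))"
    by (subst fun_eq_iff, subst value_fun.simps) simp
  with regular_pairing show ?case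
    by (simp only:)
next
  case (Suc n)
  have "t < T"
    using Suc.hyps(2) by simp
  have "regular (value_fun M w T (t + 1))"
    by (rule Suc.hyps(1)) (use Suc.hyps(2) in simp)
  have "value_fun M w T t = (\<lambda>\<sigma>. if \<not> sufficient_statistic \<sigma> then 0
      else SUP u\<in>U. LINT y|R. value_fun M w T (t + 1) (update w y u \<sigma>))"
    using \<open>t < T\<close> by (subst fun_eq_iff, subst value_fun.simps) simp
  with regular_step[OF \<open>regular (value_fun M w T (t + 1))\<close>] show ?case
    by (simp only:)
qed

lemma value_fun_convex:
  assumes "sufficient_statistic \<sigma>1" "sufficient_statistic \<sigma>2" "0 \<le> l" "l \<le> 1"
  shows "value_fun M w T t (\<lambda>s. l * \<sigma>1 s + (1 - l) * \<sigma>2 s)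
    \<le> l * value_fun M w T t \<sigma>1 + (1 - l) * value_fun M w T t \<sigma>2"
  using v_convex[OF regular_value_fun assms] .

end

lemma (in continuous_observation) observation_model:
  "observation_model X U K Tx Tq Qo (density lborel (\<lambda>v. ennreal (\<phi> v)))
     (\<lambda>yx x u. \<phi> (yx - h x u) / \<phi> yx)"
proof (intro observation_model.intro observation_model_axioms.intro hybrid_system_axioms)
  have \<phi>_measurable [measurable]: "\<phi> \<in> borel_measurable borel"
    using \<phi>_density by (auto simp: has_bochner_integral_iff)
  have \<phi>_mass: "(\<integral>\<^sup>+ v. ennreal (\<phi> v) \<partial>lborel) = 1"
    using \<phi>_density \<phi>_pos
    by (subst nn_integral_eq_integral) (auto simp: has_bochner_integral_iff less_imp_le)
  show "sigma_finite_measure (density lborel (\<lambda>v. ennreal (\<phi> v)))"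
    by (intro finite_measure.axioms(1) finite_measureI) (simp add: emeasure_density \<phi>_mass)
  show "0 \<le> \<phi> (yx - h x u) / \<phi> yx" for yx x u
    using \<phi>_pos by (simp add: less_imp_le)
  show "(\<lambda>(yx, x). \<phi> (yx - h x u) / \<phi> yx) \<in>
      borel_measurable (density lborel (\<lambda>v. ennreal (\<phi> v)) \<Otimes>\<^sub>M restrict_space borel X)"
    if u: "u \<in> U" for u
  proof -
    have "continuous_on X (\<lambda>x. (\<lambda>(x, u). h x u) (x, u))"
      using u by (intro continuous_on_compose2[OF h_continuous] continuous_intros) auto
    then have [measurable]: "(\<lambda>x. h x u) \<in> borel_measurable (restrict_space borel X)"
      by (intro borel_measurable_continuous_on_restrict) simp
    show ?thesis
      by measurable
  qed
  show "(\<integral>\<^sup>+ yx. ennreal (\<phi> (yx - h x u) / \<phi> yx) \<partial>density lborel (\<lambda>v. ennreal (\<phi> v))) = 1" for x u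
  proof -
    have "(\<integral>\<^sup>+ yx. ennreal (\<phi> (yx - h x u) / \<phi> yx) \<partial>density lborel (\<lambda>v. ennreal (\<phi> v)))
        = (\<integral>\<^sup>+ yx. ennreal (\<phi> yx) * ennreal (\<phi> (yx - h x u) / \<phi> yx) \<partial>lborel)"
      by (rule nn_integral_density) measurable
    also have "\<dots> = (\<integral>\<^sup>+ yx. ennreal (\<phi> (yx - h x u)) \<partial>lborel)"
    proof (rule nn_integral_cong)
      fix yx
      show "ennreal (\<phi> yx) * ennreal (\<phi> (yx - h x u) / \<phi> yx) = ennreal (\<phi> (yx - h x u))"
        using \<phi>_pos[of yx] \<phi>_pos[of "yx - h x u"] by (simp add: ennreal_mult[symmetric])
    qed
    also have "\<dots> = (\<integral>\<^sup>+ v. ennreal (\<phi> (v - h x u)) \<partial>distr lborel borel ((+) (h x u)))"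
      by (simp add: lborel_distr_plus)
    also have "\<dots> = 1"
      by (subst nn_integral_distr) (simp_all add: \<phi>_mass)
    finally show ?thesis .
  qed
qed

lemma (in discrete_observation) observation_model:
  "observation_model X U K Tx Tq Qo (uniform_count_measure UNIV)
     (\<lambda>yx x u. real CARD('p) * \<phi> yx x u)"
proof (intro observation_model.intro observation_model_axioms.intro hybrid_system_axioms)
  show "sigma_finite_measure (uniform_count_measure (UNIV :: 'p set))"
    by (rule sigma_finite_uniform_count_measure)
  show "0 \<le> real CARD('p) * \<phi> yx x u" if "x \<in> X" "u \<in> U" for yx x u
    using \<phi>_nonneg that by simp
  show "(\<lambda>(yx, x). real CARD('p) * \<phi> yx x u) \<in>
      borel_measurable (uniform_count_measure UNIV \<Otimes>\<^sub>M restrict_space borel X)"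
    if u: "u \<in> U" for u
  proof -
    have "(\<lambda>p. real CARD('p) * \<phi> yx (snd p) u) \<in>
        borel_measurable (uniform_count_measure (UNIV :: 'p set) \<Otimes>\<^sub>M restrict_space borel X)" for yx
      using \<phi>_measurable[OF u] by measurable
    moreover have "fst \<in> uniform_count_measure (UNIV :: 'p set) \<Otimes>\<^sub>M restrict_space borel X
        \<rightarrow>\<^sub>M count_space UNIV"
      by measurable
    ultimately show ?thesis
      unfolding case_prod_beta
      by (rule measurable_compose_countable'[where g = fst and I = UNIV]) simp
  qed
  show "(\<integral>\<^sup>+ yx. ennreal (real CARD('p) * \<phi> yx x u) \<partial>uniform_count_measure UNIV) = 1"
    if "x \<in> X" "u \<in> U" for x u
  proof -
    have "(\<integral>\<^sup>+ yx. ennreal (real CARD('p) * \<phi> yx x u) \<partial>uniform_count_measure UNIV)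
        = (\<Sum>yx\<in>UNIV. ennreal (\<phi> yx x u))"
      using \<phi>_nonneg that by (intro nn_integral_uniform_count_measure) auto
    then show ?thesis
      using \<phi>_nonneg \<phi>_sum that by simp
  qed
qed

theorem lemma1:
  fixes X :: "(real ^ 'n) set"
    and U :: "'u :: polish_space set"
    and K :: "((real ^ 'n) \<times> 'q :: finite) set"
    and Tx :: "real ^ 'n \<Rightarrow> real ^ 'n \<Rightarrow> 'u \<Rightarrow> 'q \<Rightarrow> real"
    and Tq :: "'q \<Rightarrow> real ^ 'n \<Rightarrow> 'q \<Rightarrow> 'u \<Rightarrow> real"
    and Qo :: "'q \<Rightarrow> 'o :: finite \<Rightarrow> 'u \<Rightarrow> real"
    and T t :: nat
    and h :: "real ^ 'n \<Rightarrow> 'u \<Rightarrow> real ^ 'n"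
    and \<phi> :: "real ^ 'n \<Rightarrow> real"
    and \<psi> :: "'p :: finite \<Rightarrow> real ^ 'n \<Rightarrow> 'u \<Rightarrow> real"
    and \<sigma>1 \<sigma>2 :: "(real ^ 'n) \<times> 'q \<Rightarrow> real"
    and l :: real
  assumes "t \<le> T"
    and "hybrid_system.sufficient_statistic X \<sigma>1"
    and "hybrid_system.sufficient_statistic X \<sigma>2"
    and "0 \<le> l" and "l \<le> 1"
  shows "(continuous_observation X U K Tx Tq Qo h \<phi> \<longrightarrow>
            continuous_observation.V X U K Tx Tq Qo h \<phi> T t (\<lambda>s. l * \<sigma>1 s + (1 - l) * \<sigma>2 s)
            \<le> l * continuous_observation.V X U K Tx Tq Qo h \<phi> T t \<sigma>1
              + (1 - l) * continuous_observation.V X U K Tx Tq Qo h \<phi> T t \<sigma>2)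
       \<and> (discrete_observation X U K Tx Tq Qo \<psi> \<longrightarrow>
            discrete_observation.V X U K Tx Tq Qo \<psi> T t (\<lambda>s. l * \<sigma>1 s + (1 - l) * \<sigma>2 s)
            \<le> l * discrete_observation.V X U K Tx Tq Qo \<psi> T t \<sigma>1
              + (1 - l) * discrete_observation.V X U K Tx Tq Qo \<psi> T t \<sigma>2)"

proof (intro conjI impI)
  assume "continuous_observation X U K Tx Tq Qo h \<phi>"
  then interpret continuous_observation X U K Tx Tq Qo h \<phi> .
  interpret observation_model X U K Tx Tq Qo
    "density lborel (\<lambda>v. ennreal (\<phi> v))" "\<lambda>yx x u. \<phi> (yx - h x u) / \<phi> yx"
    by (rule observation_model)
  show "V T t (\<lambda>s. l * \<sigma>1 s + (1 - l) * \<sigma>2 s) \<le> l * V T t \<sigma>1 + (1 - l) * V T t \<sigma>2"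
    unfolding V_def using assms(2-5) by (rule value_fun_convex)
next
  assume "discrete_observation X U K Tx Tq Qo \<psi>"
  then interpret discrete_observation X U K Tx Tq Qo \<psi> .
  interpret observation_model X U K Tx Tq Qo
    "uniform_count_measure UNIV" "\<lambda>yx x u. real CARD('p) * \<psi> yx x u"
    by (rule observation_model)
  show "V T t (\<lambda>s. l * \<sigma>1 s + (1 - l) * \<sigma>2 s) \<le> l * V T t \<sigma>1 + (1 - l) * V T t \<sigma>2"
    unfolding V_def using assms(2-5) by (rule value_fun_convex)
qed

end
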